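(* Let $\lambda>0$ and $\zeta_1\in\mathbb{W}$. For every $\zeta\in\mathbb{W}$ there exists a unique pair $(w^0,u^0)\in\mathcal{A}_{\mathrm{ad}}$ such that $$\mathscr{F}(w^0,u^0)=\min_{(w,u)\in\mathcal{A}_{\mathrm{ad}}}\mathscr{F}(w,u),\qquad \mathscr{F}(w,u)=\|w(T)-\zeta_1\|_{\mathbb{W}}^2+\lambda\int_0^T\|u(t)\|_{\mathbb{U}}^2\,\mathrm{d}t,$$ where $\mathcal{A}_{\mathrm{ad}}$ is the set of pairs $(w,u)$ with $u\in \mathrm{L}^2(J;\mathbb{U})$ and $w\in C(J;\mathbb{W})$ the mild solution, with initial value $\zeta$ and control $u$, of $$\frac{\mathrm{d}}{\mathrm{d}t}\Big[w(t)+\int_0^t\mathrm{G}(t-s)w(s)\,\mathrm{d}s\Big]=\mathrm{A}w(t)+\int_0^t\mathrm{N}(t-s)w(s)\,\mathrm{d}s+\mathrm{B}u(t),\ t\in(0,T],\qquad w(0)=\zeta.$$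
   Context: Setting. $T>0$, $J=[0,T]$. $\mathbb{W}$ is a separable reflexive Banach space whose dual $\mathbb{W}^*$ is uniformly convex; $\mathbb{U}$ is a Hilbert space identified with its dual; $\mathrm{B}:\mathbb{U}\to\mathbb{W}$ is bounded linear. $\mathcal{L}(X;Y)$ denotes bounded linear operators with the operator norm, $\mathcal{L}(X)=\mathcal{L}(X;X)$. $\mathrm{A}:D(\mathrm{A})\subseteq\mathbb{W}\to\mathbb{W}$ is a closed linear operator, $\mathrm{G}(t)$ ($t\ge0$) are bounded linear operators on $\mathbb{W}$, $\mathrm{N}(t)$ ($t\ge 0$) are closed linear operators in $\mathbb{W}$. $D_1(\mathrm{A})$ is $D(\mathrm{A})$ with the graph norm $\|z\|_1=\|z\|_{\mathbb{W}}+\|\mathrm{A}z\|_{\mathbb{W}}$. A hat denotes the Laplace transform, and $\Lambda_\nu=\{\lambda\in\mathbb{C}\setminus\{0\}:|\arg\lambda|<\nu\}$. Standing conditions. (Cd1) $\mathrm{A}$ generates an analytic semigroup on $\mathbb{W}$; there are $M_0>0$ and $\nu\in(\pi/2,\pi)$ with $\rho(\mathrm{A})\supseteq\Lambda_\nu$ and $\|\mathrm{R}(\lambda,\mathrm{A})\|_{\mathcal{L}(\mathbb{W})}\le M_0/|\lambda|$ for $\lambda\in\Lambda_\nu$, where $\mathrm{R}(\lambda,\mathrm{A})$ is the resolvent of $\mathrm{A}$. (Cd2) $\mathrm{G}:[0,\infty)\to\mathcal{L}(\mathbb{W})$ is strongly continuous, $\widehat{\mathrm{G}}(\lambda)z$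 is absolutely convergent for $z\in\mathbb{W}$, $\mathrm{Re}\,\lambda>0$; there are $\alpha>0$, $N_1,N_2>0$ and an analytic extension of $\widehat{\mathrm{G}}$ to $\Lambda_\nu$ (same notation) with $\|\widehat{\mathrm{G}}(\lambda)\|_{\mathcal{L}(\mathbb{W})}\le N_1|\lambda|^{-\alpha}$ for $\lambda\in\Lambda_\nu$ and $\|\widehat{\mathrm{G}}(\lambda)z\|_{\mathbb{W}}\le N_2|\lambda|^{-1}\|z\|_1$ for $\lambda\in\Lambda_\nu$, $z\in D(\mathrm{A})$. (Cd3) For each $t\ge0$, $\mathrm{N}(t)$ is closed linear with $D(\mathrm{A})\subseteq D(\mathrm{N}(t))$, and $\mathrm{N}(\cdot)z$ is strongly measurable on $(0,\infty)$ for $z\in D(\mathrm{A})$. There is $\varPi\in \mathrm{L}^1_{loc}(\mathbb{R}^+)$ such that $\widehat{\varPi}(\lambda)$ exists for $\mathrm{Re}\,\lambda>0$ and $\|\mathrm{N}(t)z\|_{\mathbb{W}}\le\varPi(t)\|z\|_1$ for $t>0$, $z\in D(\mathrm{A})$. The function $\widehat{\mathrm{N}}:\Lambda_{\pi/2}\to\mathcal{L}(D_1(\mathrm{A});\mathbb{W})$ has an analytic extension (same notation) to $\Lambda_\nu$ with $\|\widehat{\mathrm{N}}(\lambda)z\|_{\mathbb{W}}\le\|\widehat{\mathrm{N}}(\lambda)\|_{\mathcal{L}(D_1(\mathrm{A});\mathbb{W})}\|z\|_1$ for $z\in D(\mathrm{A})$, and $\|\widehat{\mathrm{N}}(\lambda)\|_{\mathcal{L}(D_1(\mathrm{A});\mathbb{W})}\to0$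 as $|\lambda|\to\infty$. (Cd4) There are a subspace $Y\subseteq D(\mathrm{A})$, dense in $D(\mathrm{A})$ for the graph norm, and $M_1,M_2>0$ with $\mathrm{A}(Y)\subseteq D(\mathrm{A})$, $\widehat{\mathrm{N}}(\lambda)(Y)\subseteq D(\mathrm{A})$, $\widehat{\mathrm{G}}(\lambda)(Y)\subseteq D(\mathrm{A})$, $\|\mathrm{A}\widehat{\mathrm{N}}(\lambda)z\|_{\mathbb{W}}\le M_1\|z\|_1$ and $\|\widehat{\mathrm{G}}(\lambda)z\|_1\le M_2|\lambda|^{-\alpha}\|z\|_1$ for all $\lambda\in\Lambda_\nu$, $z\in Y$. Resolvent operator. $(\mathscr{R}(t))_{t\ge0}\subset\mathcal{L}(\mathbb{W})$ denotes the resolvent operator of the homogeneous problem $\frac{\mathrm{d}}{\mathrm{d}t}[w(t)+\int_0^t\mathrm{G}(t-s)w(s)\mathrm{d}s]=\mathrm{A}w(t)+\int_0^t\mathrm{N}(t-s)w(s)\mathrm{d}s$, $w(0)=\zeta$: it is exponentially bounded, strongly continuous, $\mathscr{R}(0)=\mathrm{I}$, and for $z\in D(\mathrm{A})$ one has $\mathscr{R}(\cdot)z\in C([0,\infty);D_1(\mathrm{A}))\cap C^1((0,\infty);\mathbb{W})$ with, for every $t\ge0$, $\frac{\mathrm{d}}{\mathrm{d}t}[\mathscr{R}(t)z+\int_0^t\mathrm{G}(t-s)\mathscr{R}(s)z\,\mathrm{d}s]=\mathrm{A}\mathscr{R}(t)z+\int_0^t\mathrm{N}(t-s)\mathscr{R}(s)z\,\mathrm{d}s$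 and $\frac{\mathrm{d}}{\mathrm{d}t}[\mathscr{R}(t)z+\int_0^t\mathscr{R}(t-s)\mathrm{G}(s)z\,\mathrm{d}s]=\mathscr{R}(t)\mathrm{A}z+\int_0^t\mathscr{R}(t-s)\mathrm{N}(s)z\,\mathrm{d}s$. Under (Cd1)-(Cd4) it exists and is unique (known result). Mild solution. The mild solution of the controlled linear system with initial value $\zeta$ and control $u\in\mathrm{L}^2(J;\mathbb{U})$ is $w(t)=\mathscr{R}(t)\zeta+\int_0^t\mathscr{R}(t-s)\mathrm{B}u(s)\,\mathrm{d}s$, $t\in J$. *)

theory Defs
  imports "HOL-Analysis.Analysis"
begin

section \<open>Complex Banach and Hilbert spaces\<close>

class complex_banach = banach +
  fixes scaleC :: "complex \<Rightarrow> 'a \<Rightarrow> 'a" (infixr "*\<^sub>C" 75)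
  assumes scaleC_add_right: "a *\<^sub>C (x + y) = a *\<^sub>C x + a *\<^sub>C y"
    and scaleC_add_left: "(a + b) *\<^sub>C x = a *\<^sub>C x + b *\<^sub>C x"
    and scaleC_scaleC: "a *\<^sub>C (b *\<^sub>C x) = (a * b) *\<^sub>C x"
    and scaleC_of_real: "complex_of_real r *\<^sub>C x = r *\<^sub>R x"
    and norm_scaleC: "norm (a *\<^sub>C x) = cmod a * norm x"

class complex_hilbert = complex_banach +
  fixes cinner :: "'a \<Rightarrow> 'a \<Rightarrow> complex"
  assumes cinner_commute: "cinner x y = cnj (cinner y x)"
    and cinner_add_left: "cinner (x + y) z = cinner x z + cinner y z"
    and cinner_scaleC_left: "cinner (a *\<^sub>C x) y = a * cinner x y"
    and cinner_norm: "cinner x x = complex_of_real ((norm x)\<^sup>2)"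

instantiation complex :: complex_hilbert
begin

definition scaleC_complex :: "complex \<Rightarrow> complex \<Rightarrow> complex"
  where "scaleC_complex a x = a * x"

definition cinner_complex :: "complex \<Rightarrow> complex \<Rightarrow> complex"
  where "cinner_complex x y = x * cnj y"

instance
proof
  fix a b x y z :: complex and r :: real
  show "a *\<^sub>C (x + y) = a *\<^sub>C x + a *\<^sub>C y" "(a + b) *\<^sub>C x = a *\<^sub>C x + b *\<^sub>C x"
    "a *\<^sub>C (b *\<^sub>C x) = (a * b) *\<^sub>C x" "norm (a *\<^sub>C x) = cmod a * norm x"
    by (simp_all add: scaleC_complex_def algebra_simps norm_mult)
  show "complex_of_real r *\<^sub>C x = r *\<^sub>R x"
    by (simp add: scaleC_complex_def scaleR_conv_of_real)
  show "cinner x y = cnj (cinner y x)" "cinner (x + y) z = cinner x z + cinner y z"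
    "cinner (a *\<^sub>C x) y = a * cinner x y"
    by (simp_all add: scaleC_complex_def cinner_complex_def algebra_simps)
  show "cinner x x = complex_of_real ((norm x)\<^sup>2)"
    unfolding cinner_complex_def by (rule complex_norm_square[symmetric])
qed

end

section \<open>Bounded and closed linear operators\<close>

definition csubspace :: "'a::complex_banach set \<Rightarrow> bool" where
  "csubspace D \<longleftrightarrow> subspace D \<and> (\<forall>c. \<forall>x\<in>D. c *\<^sub>C x \<in> D)"

definition clinear_on :: "'a::complex_banach set \<Rightarrow> ('a \<Rightarrow> 'b::complex_banach) \<Rightarrow> bool" where
  "clinear_on D f \<longleftrightarrow>
     (\<forall>x\<in>D. \<forall>y\<in>D. f (x + y) = f x + f y) \<and> (\<forall>c. \<forall>x\<in>D. f (c *\<^sub>C x) = c *\<^sub>C f x)"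

definition bounded_clinear :: "('a::complex_banach \<Rightarrow> 'b::complex_banach) \<Rightarrow> bool" where
  "bounded_clinear f \<longleftrightarrow> bounded_linear f \<and> (\<forall>c x. f (c *\<^sub>C x) = c *\<^sub>C f x)"

text \<open>An unbounded operator is a function together with its domain; its values outside the
  domain are irrelevant.\<close>

definition closed_clinear_operator :: "'a::complex_banach set \<Rightarrow> ('a \<Rightarrow> 'a) \<Rightarrow> bool" where
  "closed_clinear_operator D f \<longleftrightarrow>
     csubspace D \<and> clinear_on D f \<and> closed ((\<lambda>z. (z, f z)) ` D)"

definition graph_norm :: "('a::complex_banach \<Rightarrow> 'a) \<Rightarrow> 'a \<Rightarrow> real" where
  "graph_norm A z = norm z + norm (A z)"

text \<open>Bounded operators from a subspace \<open>D\<close> carrying its own norm \<open>p\<close>, and their operator norm.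
  The two cases needed are \<open>D = UNIV\<close> with \<open>p = norm\<close>, where these are
  \<^const>\<open>bounded_clinear\<close> and \<^const>\<open>onorm\<close> (lemmas below), and the domain
  of the operator \<open>A\<close> with the graph norm.\<close>

definition bounded_operator_on ::
    "'a::complex_banach set \<Rightarrow> ('a \<Rightarrow> real) \<Rightarrow> ('a \<Rightarrow> 'b::complex_banach) \<Rightarrow> bool" where
  "bounded_operator_on D p f \<longleftrightarrow> clinear_on D f \<and> (\<exists>K. \<forall>z\<in>D. norm (f z) \<le> K * p z)"

definition onorm_on ::
    "'a::complex_banach set \<Rightarrow> ('a \<Rightarrow> real) \<Rightarrow> ('a \<Rightarrow> 'b::complex_banach) \<Rightarrow> real" where
  "onorm_on D p f = (SUP z\<in>D. norm (f z) / p z)"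

lemma bounded_operator_on_UNIV: "bounded_operator_on UNIV norm f \<longleftrightarrow> bounded_clinear f"
proof
  assume *: "bounded_operator_on UNIV norm f"
  then obtain K where K: "\<And>z. norm (f z) \<le> K * norm z"
    by (auto simp: bounded_operator_on_def)
  have lin: "f (x + y) = f x + f y" "f (c *\<^sub>C x) = c *\<^sub>C f x" for x y c
    using * by (auto simp: bounded_operator_on_def clinear_on_def)
  have "bounded_linear f"
  proof (rule bounded_linear_intro)
    show "f (r *\<^sub>R x) = r *\<^sub>R f x" for r x
      using lin(2)[of "complex_of_real r" x] by (simp add: scaleC_of_real)
    show "norm (f x) \<le> norm x * K" for x
      using K[of x] by (simp add: mult.commute)
  qed (rule lin)
  then show "bounded_clinear f"
    by (simp add: bounded_clinear_def lin)
next
  assume *: "bounded_clinear f"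
  then interpret bounded_linear f by (simp add: bounded_clinear_def)
  show "bounded_operator_on UNIV norm f"
    using * bounded
    by (auto simp: bounded_operator_on_def clinear_on_def bounded_clinear_def add mult.commute)
qed

lemma onorm_on_UNIV: "onorm_on UNIV norm f = onorm f"
  by (simp add: onorm_on_def onorm_def)

definition operator_analytic_on ::
    "'a::complex_banach set \<Rightarrow> ('a \<Rightarrow> real) \<Rightarrow> (complex \<Rightarrow> 'a \<Rightarrow> 'b::complex_banach) \<Rightarrow> complex set \<Rightarrow> bool"
  where
  "operator_analytic_on D p F S \<longleftrightarrow>
     (\<forall>\<zeta>\<in>S. bounded_operator_on D p (F \<zeta>)) \<and>
     (\<forall>\<zeta>\<in>S. \<exists>L. bounded_operator_on D p L \<and>
        ((\<lambda>\<xi>. onorm_on D p (\<lambda>z. inverse (\<xi> - \<zeta>) *\<^sub>C (F \<xi> z - F \<zeta> z) - L z)) \<longlongrightarrow> 0)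
          (at \<zeta> within S))"

section \<open>Reflexivity and uniform convexity of the dual\<close>

definition dual_space :: "('a::complex_banach \<Rightarrow> complex) set" where
  "dual_space = {f. bounded_clinear f}"

definition bidual_space :: "(('a::complex_banach \<Rightarrow> complex) \<Rightarrow> complex) set" where
  "bidual_space = {\<Phi>.
     (\<forall>f\<in>dual_space. \<forall>g\<in>dual_space. \<Phi> (\<lambda>x. f x + g x) = \<Phi> f + \<Phi> g) \<and>
     (\<forall>c. \<forall>f\<in>dual_space. \<Phi> (\<lambda>x. c * f x) = c * \<Phi> f) \<and>
     (\<exists>K. \<forall>f\<in>dual_space. cmod (\<Phi> f) \<le> K * onorm f)}"

definition reflexive_space :: "'a::complex_banach itself \<Rightarrow> bool" where
  "reflexive_space TYPE('a) \<longleftrightarrow>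
     (\<forall>\<Phi>\<in>bidual_space. \<exists>z::'a. \<forall>f\<in>dual_space. \<Phi> f = f z)"

definition uniformly_convex_dual :: "'a::complex_banach itself \<Rightarrow> bool" where
  "uniformly_convex_dual TYPE('a) \<longleftrightarrow>
     (\<forall>\<epsilon>>0. \<exists>\<delta>>0. \<forall>f\<in>dual_space. \<forall>g\<in>dual_space.
        onorm f = 1 \<longrightarrow> onorm (g :: 'a \<Rightarrow> complex) = 1 \<longrightarrow> onorm (\<lambda>x. f x - g x) \<ge> \<epsilon> \<longrightarrow>
        onorm (\<lambda>x. (f x + g x) / 2) \<le> 1 - \<delta>)"

section \<open>Vector-valued functions and the Laplace transform\<close>

text \<open>Bochner's strong measurability; it makes no separability assumption on the range space.\<close>

definition strongly_measurable :: "'a measure \<Rightarrow> ('a \<Rightarrow> 'b::topological_space) \<Rightarrow> bool" where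
  "strongly_measurable M f \<longleftrightarrow>
     (\<exists>s. (\<forall>i::nat. simple_function M (s i)) \<and> (AE x in M. (\<lambda>i. s i x) \<longlonglongrightarrow> f x))"

definition laplace_convergent ::
    "(real \<Rightarrow> 'a::{complex_banach, second_countable_topology}) \<Rightarrow> complex \<Rightarrow> bool" where
  "laplace_convergent f \<xi> \<longleftrightarrow>
     integrable (lebesgue_on {0..}) (\<lambda>t. exp (- (\<xi> * complex_of_real t)) *\<^sub>C f t)"

definition laplace ::
    "(real \<Rightarrow> 'a::{complex_banach, second_countable_topology}) \<Rightarrow> complex \<Rightarrow> 'a" where
  "laplace f \<xi> = (LINT t|lebesgue_on {0..}. exp (- (\<xi> * complex_of_real t)) *\<^sub>C f t)"

definition sector :: "real \<Rightarrow> complex set" where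
  "sector \<nu> = {\<xi>. \<xi> \<noteq> 0 \<and> \<bar>Arg \<xi>\<bar> < \<nu>}"

section \<open>Generators of analytic semigroups, resolvents\<close>

definition c0_semigroup :: "(real \<Rightarrow> 'a::complex_banach \<Rightarrow> 'a) \<Rightarrow> bool" where
  "c0_semigroup S \<longleftrightarrow>
     (\<forall>t\<ge>0. bounded_clinear (S t)) \<and> S 0 = id \<and>
     (\<forall>s\<ge>0. \<forall>t\<ge>0. S (s + t) = S s \<circ> S t) \<and>
     (\<forall>z. ((\<lambda>t. S t z) \<longlongrightarrow> z) (at_right 0))"

definition is_generator ::
    "(real \<Rightarrow> 'a::complex_banach \<Rightarrow> 'a) \<Rightarrow> 'a set \<Rightarrow> ('a \<Rightarrow> 'a) \<Rightarrow> bool" where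
  "is_generator S D A \<longleftrightarrow>
     D = {z. \<exists>y. ((\<lambda>t. (S t z - z) /\<^sub>R t) \<longlongrightarrow> y) (at_right 0)} \<and>
     (\<forall>z\<in>D. ((\<lambda>t. (S t z - z) /\<^sub>R t) \<longlongrightarrow> A z) (at_right 0))"

definition analytic_extension_semigroup ::
    "real \<Rightarrow> (real \<Rightarrow> 'a::complex_banach \<Rightarrow> 'a) \<Rightarrow> (complex \<Rightarrow> 'a \<Rightarrow> 'a) \<Rightarrow> bool" where
  "analytic_extension_semigroup \<theta> S E \<longleftrightarrow>
     operator_analytic_on UNIV norm E (sector \<theta>) \<and>
     (\<forall>t\<ge>0. E (complex_of_real t) = S t) \<and>
     (\<forall>\<xi>\<in>sector \<theta>. \<forall>\<eta>\<in>sector \<theta>. \<xi> + \<eta> \<in> sector \<theta> \<longrightarrow> E (\<xi> + \<eta>) = E \<xi> \<circ> E \<eta>) \<and>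
     (\<forall>z. ((\<lambda>\<xi>. E \<xi> z) \<longlongrightarrow> z) (at 0 within sector \<theta>))"

definition generates_analytic_semigroup :: "'a::complex_banach set \<Rightarrow> ('a \<Rightarrow> 'a) \<Rightarrow> bool" where
  "generates_analytic_semigroup D A \<longleftrightarrow>
     (\<exists>S \<theta> E. c0_semigroup S \<and> is_generator S D A \<and>
        0 < \<theta> \<and> \<theta> \<le> pi / 2 \<and> analytic_extension_semigroup \<theta> S E)"

definition resolvent :: "'a::complex_banach set \<Rightarrow> ('a \<Rightarrow> 'a) \<Rightarrow> complex \<Rightarrow> 'a \<Rightarrow> 'a" where
  "resolvent D A \<xi> = inv_into D (\<lambda>z. \<xi> *\<^sub>C z - A z)"

definition resolvent_set :: "'a::complex_banach set \<Rightarrow> ('a \<Rightarrow> 'a) \<Rightarrow> complex set" where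
  "resolvent_set D A =
     {\<xi>. bij_betw (\<lambda>z. \<xi> *\<^sub>C z - A z) D UNIV \<and> bounded_clinear (resolvent D A \<xi>)}"

section \<open>The standing conditions\<close>

definition Cd1 :: "'w::complex_banach set \<Rightarrow> ('w \<Rightarrow> 'w) \<Rightarrow> real \<Rightarrow> real \<Rightarrow> bool" where
  "Cd1 DA A \<nu> M0 \<longleftrightarrow>
     generates_analytic_semigroup DA A \<and>
     M0 > 0 \<and> pi / 2 < \<nu> \<and> \<nu> < pi \<and>
     sector \<nu> \<subseteq> resolvent_set DA A \<and>
     (\<forall>\<xi>\<in>sector \<nu>. onorm (resolvent DA A \<xi>) \<le> M0 / cmod \<xi>)"

text \<open>\<open>Gh\<close> is the analytic extension of the Laplace transform of \<open>G\<close> to the sector.\<close>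

definition Cd2 ::
    "'w::{complex_banach, second_countable_topology} set \<Rightarrow> ('w \<Rightarrow> 'w) \<Rightarrow> real \<Rightarrow>
     (real \<Rightarrow> 'w \<Rightarrow> 'w) \<Rightarrow> (complex \<Rightarrow> 'w \<Rightarrow> 'w) \<Rightarrow> real \<Rightarrow> real \<Rightarrow> real \<Rightarrow> bool" where
  "Cd2 DA A \<nu> G Gh \<alpha> N1 N2 \<longleftrightarrow>
     (\<forall>t\<ge>0. bounded_clinear (G t)) \<and>
     (\<forall>z. continuous_on {0..} (\<lambda>t. G t z)) \<and>
     (\<forall>z \<xi>. Re \<xi> > 0 \<longrightarrow> laplace_convergent (\<lambda>t. G t z) \<xi>) \<and>
     \<alpha> > 0 \<and> N1 > 0 \<and> N2 > 0 \<and>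
     (\<forall>z \<xi>. Re \<xi> > 0 \<longrightarrow> Gh \<xi> z = laplace (\<lambda>t. G t z) \<xi>) \<and>
     operator_analytic_on UNIV norm Gh (sector \<nu>) \<and>
     (\<forall>\<xi>\<in>sector \<nu>. onorm (Gh \<xi>) \<le> N1 * cmod \<xi> powr (- \<alpha>)) \<and>
     (\<forall>\<xi>\<in>sector \<nu>. \<forall>z\<in>DA. norm (Gh \<xi> z) \<le> N2 / cmod \<xi> * graph_norm A z)"

text \<open>\<open>DN t\<close> is the domain of \<open>N t\<close>, \<open>P\<close> is the locally integrable majorant, and \<open>Nh\<close> is the
  analytic extension of the Laplace transform of \<open>N\<close> to the sector, with values in the bounded
  operators on \<open>DA\<close> with the graph norm.\<close>

definition Cd3 ::
    "'w::{complex_banach, second_countable_topology} set \<Rightarrow> ('w \<Rightarrow> 'w) \<Rightarrow> real \<Rightarrow>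
     (real \<Rightarrow> 'w set) \<Rightarrow> (real \<Rightarrow> 'w \<Rightarrow> 'w) \<Rightarrow> (complex \<Rightarrow> 'w \<Rightarrow> 'w) \<Rightarrow> (real \<Rightarrow> real) \<Rightarrow> bool" where
  "Cd3 DA A \<nu> DN N Nh P \<longleftrightarrow>
     (\<forall>t\<ge>0. closed_clinear_operator (DN t) (N t) \<and> DA \<subseteq> DN t) \<and>
     (\<forall>z\<in>DA. strongly_measurable (lebesgue_on {0<..}) (\<lambda>t. N t z)) \<and>
     (\<forall>a\<ge>0. integrable (lebesgue_on {0..a}) P) \<and>
     (\<forall>\<xi>. Re \<xi> > 0 \<longrightarrow> laplace_convergent (\<lambda>t. complex_of_real (P t)) \<xi>) \<and>
     (\<forall>t>0. \<forall>z\<in>DA. norm (N t z) \<le> P t * graph_norm A z) \<and>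
     (\<forall>\<xi>. Re \<xi> > 0 \<longrightarrow> (\<forall>z\<in>DA. Nh \<xi> z = laplace (\<lambda>t. N t z) \<xi>)) \<and>
     operator_analytic_on DA (graph_norm A) Nh (sector \<nu>) \<and>
     (\<forall>\<xi>\<in>sector \<nu>. \<forall>z\<in>DA.
        norm (Nh \<xi> z) \<le> onorm_on DA (graph_norm A) (Nh \<xi>) * graph_norm A z) \<and>
     ((\<lambda>\<xi>. onorm_on DA (graph_norm A) (Nh \<xi>)) \<longlongrightarrow> 0) (inf at_infinity (principal (sector \<nu>)))"

definition Cd4 ::
    "'w::complex_banach set \<Rightarrow> ('w \<Rightarrow> 'w) \<Rightarrow> real \<Rightarrow> (complex \<Rightarrow> 'w \<Rightarrow> 'w) \<Rightarrow> real \<Rightarrow>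
     (complex \<Rightarrow> 'w \<Rightarrow> 'w) \<Rightarrow> 'w set \<Rightarrow> real \<Rightarrow> real \<Rightarrow> bool" where
  "Cd4 DA A \<nu> Gh \<alpha> Nh Y M1 M2 \<longleftrightarrow>
     csubspace Y \<and> Y \<subseteq> DA \<and>
     (\<forall>z\<in>DA. \<forall>\<epsilon>>0. \<exists>y\<in>Y. graph_norm A (z - y) < \<epsilon>) \<and>
     M1 > 0 \<and> M2 > 0 \<and>
     A ` Y \<subseteq> DA \<and>
     (\<forall>\<xi>\<in>sector \<nu>. Nh \<xi> ` Y \<subseteq> DA \<and> Gh \<xi> ` Y \<subseteq> DA) \<and>
     (\<forall>\<xi>\<in>sector \<nu>. \<forall>z\<in>Y. norm (A (Nh \<xi> z)) \<le> M1 * graph_norm A z) \<and>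
     (\<forall>\<xi>\<in>sector \<nu>. \<forall>z\<in>Y. graph_norm A (Gh \<xi> z) \<le> M2 * cmod \<xi> powr (- \<alpha>) * graph_norm A z)"

section \<open>Resolvent operator, mild solutions and the cost functional\<close>

definition resolvent_operator ::
    "'w::{complex_banach, second_countable_topology} set \<Rightarrow> ('w \<Rightarrow> 'w) \<Rightarrow> (real \<Rightarrow> 'w \<Rightarrow> 'w) \<Rightarrow>
     (real \<Rightarrow> 'w \<Rightarrow> 'w) \<Rightarrow> (real \<Rightarrow> 'w \<Rightarrow> 'w) \<Rightarrow> bool" where
  "resolvent_operator DA A G N R \<longleftrightarrow>
     (\<forall>t\<ge>0. bounded_clinear (R t)) \<and>
     (\<exists>M \<omega>. \<forall>t\<ge>0. onorm (R t) \<le> M * exp (\<omega> * t)) \<and>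
     (\<forall>z. continuous_on {0..} (\<lambda>t. R t z)) \<and>
     R 0 = id \<and>
     (\<forall>z\<in>DA.
        (\<forall>t\<ge>0. R t z \<in> DA) \<and>
        (\<forall>t\<ge>0. ((\<lambda>s. graph_norm A (R s z - R t z)) \<longlongrightarrow> 0) (at t within {0..})) \<and>
        (\<lambda>t. R t z) C1_differentiable_on {0<..} \<and>
        (\<forall>t\<ge>0.
          ((\<lambda>t. R t z + (LINT s|lebesgue_on {0..t}. G (t - s) (R s z))) has_vector_derivative
             A (R t z) + (LINT s|lebesgue_on {0..t}. N (t - s) (R s z))) (at t within {0..}) \<and>
          ((\<lambda>t. R t z + (LINT s|lebesgue_on {0..t}. R (t - s) (G s z))) has_vector_derivative
             R t (A z) + (LINT s|lebesgue_on {0..t}. R (t - s) (N s z))) (at t within {0..})))"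

definition square_integrable :: "real \<Rightarrow> (real \<Rightarrow> 'u::complex_hilbert) \<Rightarrow> bool" where
  "square_integrable T u \<longleftrightarrow>
     strongly_measurable (lebesgue_on {0..T}) u \<and>
     integrable (lebesgue_on {0..T}) (\<lambda>t. (norm (u t))\<^sup>2)"

definition ae_equal :: "real \<Rightarrow> ((real \<Rightarrow> 'u::complex_hilbert) \<times> (real \<Rightarrow> 'u)) set" where
  "ae_equal T = {(u, v). square_integrable T u \<and> square_integrable T v \<and>
     (AE t in lebesgue_on {0..T}. u t = v t)}"

text \<open>The elements of \<open>L2_space T\<close> are classes of functions modulo equality almost everywhere
  on the interval from \<open>0\<close> to \<open>T\<close>.\<close>

definition L2_space :: "real \<Rightarrow> (real \<Rightarrow> 'u::complex_hilbert) set set" where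
  "L2_space T = Collect (square_integrable T) // ae_equal T"

definition L2_norm_sq :: "real \<Rightarrow> (real \<Rightarrow> 'u::complex_hilbert) set \<Rightarrow> real" where
  "L2_norm_sq T U = (LINT t|lebesgue_on {0..T}. (norm ((SOME u. u \<in> U) t))\<^sup>2)"

lemma L2_norm_sq_eq:
  assumes "U \<in> L2_space T" and "u \<in> U"
  shows "L2_norm_sq T U = (LINT t|lebesgue_on {0..T}. (norm (u t))\<^sup>2)"
proof -
  let ?v = "SOME u. u \<in> U"
  have "?v \<in> U" using assms(2) by (metis someI)
  moreover obtain w where "U = ae_equal T `` {w}"
    using assms(1) by (auto simp: L2_space_def quotient_def)
  ultimately have *: "(w, u) \<in> ae_equal T" "(w, ?v) \<in> ae_equal T" using assms(2) by auto
  have m: "(\<lambda>t. (norm (x t))\<^sup>2) \<in> borel_measurable (lebesgue_on {0..T})"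
    if "(w, x) \<in> ae_equal T" for x
    using that by (auto simp: ae_equal_def square_integrable_def)
  have "AE t in lebesgue_on {0..T}. w t = u t" "AE t in lebesgue_on {0..T}. w t = ?v t"
    using * by (auto simp: ae_equal_def)
  then have "AE t in lebesgue_on {0..T}. (norm (?v t))\<^sup>2 = (norm (u t))\<^sup>2"
    by eventually_elim simp
  then show ?thesis
    unfolding L2_norm_sq_def by (intro integral_cong_AE m *)
qed

definition mild_solution ::
    "real \<Rightarrow> (real \<Rightarrow> 'w::{complex_banach, second_countable_topology} \<Rightarrow> 'w) \<Rightarrow>
     ('u::complex_hilbert \<Rightarrow> 'w) \<Rightarrow> 'w \<Rightarrow> (real \<Rightarrow> 'u) \<Rightarrow> (real \<Rightarrow> 'w) \<Rightarrow> bool" where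
  "mild_solution T R B \<zeta> u w \<longleftrightarrow>
     (\<forall>t\<in>{0..T}. w t = R t \<zeta> + (LINT s|lebesgue_on {0..t}. R (t - s) (B (u s))))"

text \<open>The state \<open>w\<close> is a function on the interval from \<open>0\<close> to \<open>T\<close> only; it is represented by its
  extension with the value \<^const>\<open>undefined\<close> outside.\<close>

definition admissible ::
    "real \<Rightarrow> (real \<Rightarrow> 'w::{complex_banach, second_countable_topology} \<Rightarrow> 'w) \<Rightarrow>
     ('u::complex_hilbert \<Rightarrow> 'w) \<Rightarrow> 'w \<Rightarrow> ((real \<Rightarrow> 'w) \<times> (real \<Rightarrow> 'u) set) set" where
  "admissible T R B \<zeta> = {(w, U). U \<in> L2_space T \<and>
     w \<in> extensional {0..T} \<and> continuous_on {0..T} w \<and>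
     (\<forall>u\<in>U. mild_solution T R B \<zeta> u w)}"

definition cost ::
    "real \<Rightarrow> real \<Rightarrow> 'w::complex_banach \<Rightarrow> (real \<Rightarrow> 'w) \<times> (real \<Rightarrow> 'u::complex_hilbert) set \<Rightarrow> real" where
  "cost T \<kappa> \<zeta>1 = (\<lambda>(w, U). (norm (w T - \<zeta>1))\<^sup>2 + \<kappa> * L2_norm_sq T U)"

end

theory Submission
  imports Defs
begin

text \<open>The cost is strictly convex because of the parallelogram law in the control space: if two
  controls have cost within \<open>\<delta>\<close> of the infimum, then comparing with their midpoint shows that they
  are within \<open>4 \<delta> / \<kappa>\<close> of each other in the squared \<open>L\<^sup>2\<close> norm. Hence a minimising sequence of
  controls is Cauchy and converges strongly, and the final state depends continuously on the
  control, so no weak compactness is needed. The midpoint estimate with \<open>\<delta> = 0\<close> gives uniqueness.\<close>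

lemma borel_measurable_AE_limit:
  fixes f :: "nat \<Rightarrow> 'a \<Rightarrow> 'b::metric_space"
  assumes "complete_measure M"
    and f: "\<And>i. f i \<in> borel_measurable M"
    and lim: "AE x in M. (\<lambda>i. f i x) \<longlonglongrightarrow> g x"
  shows "g \<in> borel_measurable M"
proof -
  interpret complete_measure M by fact
  obtain N where N: "N \<in> null_sets M" "\<And>x. x \<in> space M - N \<Longrightarrow> (\<lambda>i. f i x) \<longlonglongrightarrow> g x"
    using AE_E3[OF lim] by blast
  define h where "h x = (if x \<in> N then undefined else g x)" for x
  have h: "h \<in> borel_measurable M"
  proof (rule borel_measurable_LIMSEQ_metric)
    show "(\<lambda>x. if x \<in> N then undefined else f i x) \<in> borel_measurable M" for i
      using N(1) f by (intro measurable_If_set) auto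
    show "(\<lambda>i. if x \<in> N then undefined else f i x) \<longlonglongrightarrow> h x" if "x \<in> space M" for x
      using N(2)[of x] that by (auto simp: h_def)
  qed
  show ?thesis
  proof (rule measurableI)
    fix S :: "'b set" assume S: "S \<in> sets borel"
    show "g -` S \<inter> space M \<in> sets M"
    proof (rule in_sets_AE)
      show "h -` S \<inter> space M \<in> sets M"
        using h S by (rule measurable_sets)
      show "AE x in M. (x \<in> h -` S \<inter> space M) = (x \<in> g -` S \<inter> space M)"
        by (rule AE_I'[OF N(1)]) (auto simp: h_def)
    qed auto
  qed auto
qed

lemma strongly_measurable_imp_borel:
  fixes f :: "'a \<Rightarrow> 'b::metric_space"
  assumes "complete_measure M" "strongly_measurable M f"
  shows "f \<in> borel_measurable M"
proof -
  obtain s where s: "\<And>i::nat. simple_function M (s i)" "AE x in M. (\<lambda>i. s i x) \<longlonglongrightarrow> f x"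
    using assms(2) unfolding strongly_measurable_def by metis
  from borel_measurable_AE_limit[OF assms(1) borel_measurable_simple_function[OF s(1)] s(2)]
  show ?thesis .
qed

lemma strongly_measurable_add:
  fixes f g :: "'a \<Rightarrow> 'b::real_normed_vector"
  assumes "strongly_measurable M f" "strongly_measurable M g"
  shows "strongly_measurable M (\<lambda>x. f x + g x)"
proof -
  obtain s where s: "\<And>i::nat. simple_function M (s i)" "AE x in M. (\<lambda>i. s i x) \<longlonglongrightarrow> f x"
    using assms(1) unfolding strongly_measurable_def by metis
  obtain t where t: "\<And>i::nat. simple_function M (t i)" "AE x in M. (\<lambda>i. t i x) \<longlonglongrightarrow> g x"
    using assms(2) unfolding strongly_measurable_def by metis
  have "simple_function M (\<lambda>x. s i x + t i x)" for i
    using s(1) t(1) by (rule simple_function_compose2)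
  moreover have "AE x in M. (\<lambda>i. s i x + t i x) \<longlonglongrightarrow> f x + g x"
    using s(2) t(2) by eventually_elim (rule tendsto_add)
  ultimately show ?thesis
    unfolding strongly_measurable_def by (intro exI[of _ "\<lambda>i x. s i x + t i x"]) simp
qed

lemma strongly_measurable_bounded_linear:
  assumes "bounded_linear h" "strongly_measurable M f"
  shows "strongly_measurable M (\<lambda>x. h (f x))"
proof -
  obtain s where s: "\<And>i::nat. simple_function M (s i)" "AE x in M. (\<lambda>i. s i x) \<longlonglongrightarrow> f x"
    using assms(2) unfolding strongly_measurable_def by metis
  have "simple_function M (\<lambda>x. h (s i x))" for i
    using simple_function_compose[OF s(1), of h] by (simp add: comp_def)
  moreover have "AE x in M. (\<lambda>i. h (s i x)) \<longlonglongrightarrow> h (f x)"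
    using s(2) by eventually_elim (rule bounded_linear.tendsto[OF assms(1)])
  ultimately show ?thesis
    unfolding strongly_measurable_def by (intro exI[of _ "\<lambda>i x. h (s i x)"]) simp
qed

lemma norm_add_sq_le:
  fixes x y :: "'a::real_normed_vector"
  assumes "\<epsilon> > 0"
  shows "(norm (x + y))\<^sup>2 \<le> (1 + \<epsilon>) * (norm x)\<^sup>2 + (1 + 1 / \<epsilon>) * (norm y)\<^sup>2"
proof -
  have "(norm (x + y))\<^sup>2 \<le> (norm x + norm y)\<^sup>2"
    by (simp add: norm_triangle_ineq power_mono)
  moreover have "0 \<le> (\<epsilon> * norm x - norm y)\<^sup>2 / \<epsilon>"
    using assms by simp
  then have "2 * (norm x * norm y) \<le> \<epsilon> * (norm x)\<^sup>2 + (norm y)\<^sup>2 / \<epsilon>"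
    using assms by (simp add: power2_eq_square field_simps)
  ultimately show ?thesis
    by (simp add: power2_sum algebra_simps)
qed

lemma norm_add_sq_le_2:
  fixes x y :: "'a::real_normed_vector"
  shows "(norm (x + y))\<^sup>2 \<le> 2 * (norm x)\<^sup>2 + 2 * (norm y)\<^sup>2"
  using norm_add_sq_le[of 1 x y] by simp

definition L2_function :: "'a measure \<Rightarrow> ('a \<Rightarrow> 'b::real_normed_vector) \<Rightarrow> bool" where
  "L2_function M u \<longleftrightarrow> strongly_measurable M u \<and> integrable M (\<lambda>x. (norm (u x))\<^sup>2)"

lemma L2_function_add:
  assumes "complete_measure M" and u: "L2_function M u" and v: "L2_function M v"
  shows "L2_function M (\<lambda>x. u x + v x)"
  unfolding L2_function_def
proof
  show *: "strongly_measurable M (\<lambda>x. u x + v x)"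
    using u v by (auto simp: L2_function_def intro: strongly_measurable_add)
  show "integrable M (\<lambda>x. (norm (u x + v x))\<^sup>2)"
  proof (rule Bochner_Integration.integrable_bound)
    show "integrable M (\<lambda>x. 2 * (norm (u x))\<^sup>2 + 2 * (norm (v x))\<^sup>2)"
      using u v by (auto simp: L2_function_def)
    show "(\<lambda>x. (norm (u x + v x))\<^sup>2) \<in> borel_measurable M"
      using strongly_measurable_imp_borel[OF assms(1) *] by measurable
  qed (simp add: norm_add_sq_le_2)
qed

lemma L2_function_scaleR:
  assumes "L2_function M u"
  shows "L2_function M (\<lambda>x. c *\<^sub>R u x)"
  using assms strongly_measurable_bounded_linear[OF bounded_linear_scaleR_right, of M u c]
  by (simp add: L2_function_def power_mult_distrib)

lemma L2_function_diff:
  assumes "complete_measure M" "L2_function M u" "L2_function M v"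
  shows "L2_function M (\<lambda>x. u x - v x)"
  using L2_function_add[OF assms(1,2) L2_function_scaleR[OF assms(3), of "-1"]] by simp

lemma L2_function_simple_approx:
  assumes cm: "complete_measure M" and u: "L2_function M u" and "\<epsilon> > 0"
  obtains s where "simple_function M s" "L2_function M s" "(LINT x|M. (norm (s x - u x))\<^sup>2) < \<epsilon>"
proof -
  obtain s where s: "\<And>i::nat. simple_function M (s i)" "AE x in M. (\<lambda>i. s i x) \<longlonglongrightarrow> u x"
    using u unfolding L2_function_def strongly_measurable_def by metis
  have bu [measurable]: "u \<in> borel_measurable M"
    using u by (intro strongly_measurable_imp_borel cm) (auto simp: L2_function_def)
  define s' where "s' i x = (if norm (s i x) \<le> 2 * norm (u x) then s i x else 0)" for i x
  have simp': "simple_function M (s' i)" for i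
  proof -
    have [measurable]: "s i \<in> borel_measurable M"
      using s(1) by (rule borel_measurable_simple_function)
    have "simple_function M (\<lambda>x. indicator {x\<in>space M. norm (s i x) \<le> 2 * norm (u x)} x :: real)"
      by (intro simple_function_indicator) measurable
    from simple_function_compose2[OF this s(1), of scaleR i]
    show ?thesis
      by (rule simple_function_cong[THEN iffD1, rotated]) (auto simp: s'_def)
  qed
  have le: "norm (s' i x - u x) \<le> 3 * norm (u x)" for i x
    using norm_triangle_ineq4[of "s' i x" "u x"] by (auto simp: s'_def split: if_splits)
  have le2: "(norm (s' i x - u x))\<^sup>2 \<le> 9 * (norm (u x))\<^sup>2" for i x
    using power_mono[OF le, of i x 2] by (simp add: power_mult_distrib)
  have lim: "AE x in M. (\<lambda>i. s' i x) \<longlonglongrightarrow> u x"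
    using s(2)
  proof eventually_elim
    case (elim x)
    show ?case
    proof (cases "u x = 0")
      case True
      have "s' i x = 0" for i using True by (simp add: s'_def)
      then show ?thesis using True by simp
    next
      case False
      have "(\<lambda>i. norm (s i x)) \<longlonglongrightarrow> norm (u x)" using elim by (rule tendsto_norm)
      then have "\<forall>\<^sub>F i in sequentially. norm (s i x) < 2 * norm (u x)"
        using False by (intro order_tendstoD) auto
      then have "\<forall>\<^sub>F i in sequentially. s i x = s' i x"
        by eventually_elim (simp add: s'_def)
      with elim show ?thesis by (rule Lim_transform_eventually)
    qed
  qed
  have [measurable]: "s' i \<in> borel_measurable M" for i
    using simp' by (rule borel_measurable_simple_function)
  have m: "(\<lambda>x. (norm (s' i x - u x))\<^sup>2) \<in> borel_measurable M" for i
  proof -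
    have "strongly_measurable M (s' i)"
      unfolding strongly_measurable_def using simp' by (intro exI[of _ "\<lambda>_. s' i"]) simp
    moreover have "strongly_measurable M (\<lambda>x. (-1) *\<^sub>R u x)"
      using u by (intro strongly_measurable_bounded_linear[OF bounded_linear_scaleR_right])
        (simp add: L2_function_def)
    ultimately have "strongly_measurable M (\<lambda>x. s' i x + (-1) *\<^sub>R u x)"
      by (rule strongly_measurable_add)
    from strongly_measurable_imp_borel[OF cm this]
    have "(\<lambda>x. (norm (s' i x + (-1) *\<^sub>R u x))\<^sup>2) \<in> borel_measurable M"
      by measurable
    then show ?thesis by simp
  qed
  have "(\<lambda>i. LINT x|M. (norm (s' i x - u x))\<^sup>2) \<longlonglongrightarrow> (LINT x|M. 0)"
  proof (rule integral_dominated_convergence[where w="\<lambda>x. 9 * (norm (u x))\<^sup>2"])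
    show "AE x in M. (\<lambda>i. (norm (s' i x - u x))\<^sup>2) \<longlonglongrightarrow> 0"
      using lim
    proof eventually_elim
      case (elim x)
      then have "(\<lambda>i. norm (s' i x - u x)) \<longlonglongrightarrow> 0"
        using LIM_zero tendsto_norm_zero by blast
      then show ?case using tendsto_power[of _ 0 _ 2] by fastforce
    qed
  qed (use u m le2 in \<open>auto simp: L2_function_def\<close>)
  then have "\<forall>\<^sub>F i in sequentially. (LINT x|M. (norm (s' i x - u x))\<^sup>2) < \<epsilon>"
    using \<open>\<epsilon> > 0\<close> by (intro order_tendstoD) auto
  then obtain i where i: "(LINT x|M. (norm (s' i x - u x))\<^sup>2) < \<epsilon>"
    by (auto simp: eventually_sequentially)
  have "L2_function M (s' i)"
    unfolding L2_function_def
  proof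
    show "strongly_measurable M (s' i)"
      unfolding strongly_measurable_def using simp' by (intro exI[of _ "\<lambda>_. s' i"]) simp
    show "integrable M (\<lambda>x. (norm (s' i x))\<^sup>2)"
    proof (rule Bochner_Integration.integrable_bound)
      show "integrable M (\<lambda>x. 4 * (norm (u x))\<^sup>2)" using u by (simp add: L2_function_def)
      have "(norm (s' i x))\<^sup>2 \<le> (2 * norm (u x))\<^sup>2" for x
        by (intro power_mono) (auto simp: s'_def)
      then show "AE x in M. norm ((norm (s' i x))\<^sup>2) \<le> norm (4 * (norm (u x))\<^sup>2)"
        by (simp add: power_mult_distrib)
    qed measurable
  qed
  with that simp' i show thesis by blast
qed

lemma integral_norm_sq_add_le:
  assumes cm: "complete_measure M" and u: "L2_function M u" and v: "L2_function M v"
  shows "(LINT x|M. (norm (u x + v x))\<^sup>2) \<le> 2 * (LINT x|M. (norm (u x))\<^sup>2) + 2 * (LINT x|M. (norm (v x))\<^sup>2)"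
proof -
  have "(LINT x|M. (norm (u x + v x))\<^sup>2) \<le> (LINT x|M. 2 * (norm (u x))\<^sup>2 + 2 * (norm (v x))\<^sup>2)"
    using u v L2_function_add[OF cm u v]
    by (intro integral_mono) (auto simp: L2_function_def norm_add_sq_le_2)
  also have "\<dots> = 2 * (LINT x|M. (norm (u x))\<^sup>2) + 2 * (LINT x|M. (norm (v x))\<^sup>2)"
    using u v by (simp add: L2_function_def)
  finally show ?thesis .
qed

lemma nn_integral_norm_sq:
  "L2_function M u \<Longrightarrow> (\<integral>\<^sup>+x. ennreal ((norm (u x))\<^sup>2) \<partial>M) = ennreal (LINT x|M. (norm (u x))\<^sup>2)"
  by (intro nn_integral_eq_integral) (auto simp: L2_function_def)

lemma AE_convergent_of_fast_L2_Cauchy: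
  fixes s :: "nat \<Rightarrow> 'a \<Rightarrow> 'b::banach"
  assumes cm: "complete_measure M" and s: "\<And>n. L2_function M (s n)"
    and le: "\<And>n. (LINT x|M. (norm (s (Suc n) x - s n x))\<^sup>2) \<le> C * (1/4) ^ n"
  shows "AE x in M. convergent (\<lambda>n. s n x)"
proof -
  define d where "d n x = (norm (s (Suc n) x - s n x))\<^sup>2" for n x
  have L2: "L2_function M (\<lambda>x. s (Suc n) x - s n x)" for n
    using cm s by (intro L2_function_diff)
  have d [measurable]: "d n \<in> borel_measurable M" for n
    using L2[of n] unfolding d_def L2_function_def by auto
  have dint: "integrable M (d n)" for n
    using L2[of n] unfolding d_def L2_function_def by simp
  have d0: "d n x \<ge> 0" for n x by (simp add: d_def)
  have "0 \<le> (LINT x|M. d 0 x)" by (simp add: d0)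
  also have "\<dots> \<le> C" using le[of 0] by (simp add: d_def)
  finally have "0 \<le> C" .
  have "(\<integral>\<^sup>+x. (\<Sum>n. ennreal (2 ^ n * d n x)) \<partial>M) = (\<Sum>n. \<integral>\<^sup>+x. ennreal (2 ^ n * d n x) \<partial>M)"
    by (rule nn_integral_suminf) measurable
  also have "\<dots> \<le> (\<Sum>n. ennreal (C * (1/2) ^ n))"
  proof (intro suminf_le)
    fix n
    have "(\<integral>\<^sup>+x. ennreal (2 ^ n * d n x) \<partial>M) = ennreal (2 ^ n * (LINT x|M. d n x))"
      using dint d0 by (subst nn_integral_eq_integral) auto
    also have "\<dots> \<le> ennreal (2 ^ n * (C * (1/4) ^ n))"
      using le[of n] by (intro ennreal_leI mult_left_mono) (auto simp: d_def)
    also have "2 ^ n * (C * (1/4) ^ n) = C * (1/2::real) ^ n"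
      by (simp add: field_simps flip: power_mult_distrib)
    finally show "(\<integral>\<^sup>+x. ennreal (2 ^ n * d n x) \<partial>M) \<le> ennreal (C * (1/2) ^ n)" .
  qed auto
  also have "\<dots> = ennreal (\<Sum>n. C * (1/2) ^ n)"
    using \<open>0 \<le> C\<close> by (intro suminf_ennreal2) (auto intro!: summable_mult summable_geometric)
  finally have "(\<integral>\<^sup>+x. (\<Sum>n. ennreal (2 ^ n * d n x)) \<partial>M) \<noteq> \<infinity>"
    by (auto simp: top_unique)
  then have "AE x in M. (\<Sum>n. ennreal (2 ^ n * d n x)) \<noteq> \<infinity>"
    by (intro nn_integral_PInf_AE) measurable
  then show ?thesis
  proof eventually_elim
    case (elim x)
    have sd: "summable (\<lambda>n. 2 ^ n * d n x)"
      using elim d0 summable_iff_suminf_neq_top[of "\<lambda>n. 2 ^ n * d n x"] by fastforce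
    have sg: "summable (\<lambda>n. (1/2::real) ^ n)" by (rule summable_geometric) simp
    have "summable (\<lambda>n. s (Suc n) x - s n x)"
    proof (rule summable_comparison_test')
      show "summable (\<lambda>n. 2 ^ n * d n x + (1/2) ^ n)"
        using sd sg by (rule summable_add)
      show "norm (s (Suc n) x - s n x) \<le> 2 ^ n * d n x + (1/2) ^ n" for n
      proof -
        define a where "a = norm (s (Suc n) x - s n x)"
        have "0 \<le> (2 ^ n * a - 1)\<^sup>2 / 2 ^ n" by simp
        also have "\<dots> = 2 ^ n * a\<^sup>2 + (1/2) ^ n - 2 * a"
          by (simp add: power2_eq_square field_simps)
        finally have "2 * a \<le> 2 ^ n * a\<^sup>2 + (1/2) ^ n" by simp
        moreover have "a \<ge> 0" by (simp add: a_def)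
        ultimately have "a \<le> 2 ^ n * a\<^sup>2 + (1/2) ^ n" by linarith
        then show ?thesis by (simp add: a_def d_def)
      qed
    qed
    then show ?case
      using convergent_add_const_iff[of "s 0 x" "\<lambda>n. \<Sum>i<n. s (Suc i) x - s i x"]
        sum_lessThan_telescope[of "\<lambda>n. s n x"]
      by (simp add: summable_iff_convergent)
  qed
qed

text \<open>Passing to simple functions first makes the almost everywhere limit strongly measurable
  without any separability of the range space.\<close>

lemma L2_complete:
  fixes u :: "nat \<Rightarrow> 'a \<Rightarrow> 'b::banach"
  assumes cm: "complete_measure M" and u: "\<And>n. L2_function M (u n)"
    and le: "\<And>n m. n \<le> m \<Longrightarrow> (LINT x|M. (norm (u m x - u n x))\<^sup>2) \<le> (1/4) ^ n"
  obtains v where "L2_function M v" "(\<lambda>n. LINT x|M. (norm (v x - u n x))\<^sup>2) \<longlonglongrightarrow> 0"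
proof -
  have "\<exists>s. simple_function M s \<and> L2_function M s \<and> (LINT x|M. (norm (s x - u n x))\<^sup>2) < (1/4) ^ n" for n
    by (rule L2_function_simple_approx[OF cm u, of "(1/4) ^ n" n]) auto
  then obtain s where s: "\<And>n. simple_function M (s n)" "\<And>n. L2_function M (s n)"
    "\<And>n. (LINT x|M. (norm (s n x - u n x))\<^sup>2) < (1/4) ^ n"
    by metis
  note diff = L2_function_diff[OF cm]
  have su: "(LINT x|M. (norm (s m x - u n x))\<^sup>2) \<le> 4 * (1/4) ^ n" if "n \<le> m" for n m
  proof -
    have "(LINT x|M. (norm (s m x - u n x))\<^sup>2) \<le>
        2 * (LINT x|M. (norm (s m x - u m x))\<^sup>2) + 2 * (LINT x|M. (norm (u m x - u n x))\<^sup>2)"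
      using integral_norm_sq_add_le[OF cm diff[OF s(2) u] diff[OF u u], of m m m n] by simp
    moreover have "(1/4::real) ^ m \<le> (1/4) ^ n"
      using that by (intro power_decreasing) auto
    ultimately show ?thesis using s(3)[of m] le[OF that] by linarith
  qed
  have "(LINT x|M. (norm (s (Suc n) x - s n x))\<^sup>2) \<le> 10 * (1/4) ^ n" for n
  proof -
    have "(LINT x|M. (norm (s (Suc n) x - s n x))\<^sup>2) \<le>
        2 * (LINT x|M. (norm (s (Suc n) x - u n x))\<^sup>2) + 2 * (LINT x|M. (norm (u n x - s n x))\<^sup>2)"
      using integral_norm_sq_add_le[OF cm diff[OF s(2) u] diff[OF u s(2)], of "Suc n" n n n] by simp
    then show ?thesis
      using s(3)[of n] su[of n "Suc n"] by (simp add: norm_minus_commute)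
  qed
  then have conv: "AE x in M. convergent (\<lambda>n. s n x)"
    by (rule AE_convergent_of_fast_L2_Cauchy[OF cm s(2)])
  define v where "v x = lim (\<lambda>n. s n x)" for x
  have lim: "AE x in M. (\<lambda>n. s n x) \<longlonglongrightarrow> v x"
    using conv by eventually_elim (simp add: v_def convergent_LIMSEQ_iff)
  have sv: "strongly_measurable M v"
    unfolding strongly_measurable_def using s(1) lim by blast
  have nn: "(\<integral>\<^sup>+x. ennreal ((norm (v x - u n x))\<^sup>2) \<partial>M) \<le> ennreal (4 * (1/4) ^ n)" for n
  proof -
    have "(\<integral>\<^sup>+x. ennreal ((norm (v x - u n x))\<^sup>2) \<partial>M)
        = (\<integral>\<^sup>+x. liminf (\<lambda>m. ennreal ((norm (s m x - u n x))\<^sup>2)) \<partial>M)"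
    proof (rule nn_integral_cong_AE)
      show "AE x in M. ennreal ((norm (v x - u n x))\<^sup>2) = liminf (\<lambda>m. ennreal ((norm (s m x - u n x))\<^sup>2))"
        using lim
      proof eventually_elim
        case (elim x)
        then have "(\<lambda>m. ennreal ((norm (s m x - u n x))\<^sup>2)) \<longlonglongrightarrow> ennreal ((norm (v x - u n x))\<^sup>2)"
          by (intro tendsto_intros)
        from lim_imp_Liminf[OF _ this] show ?case by simp
      qed
    qed
    also have "\<dots> \<le> liminf (\<lambda>m. \<integral>\<^sup>+x. ennreal ((norm (s m x - u n x))\<^sup>2) \<partial>M)"
      using diff[OF s(2) u] by (intro nn_integral_liminf) (auto simp: L2_function_def)
    also have "\<dots> \<le> liminf (\<lambda>m::nat. ennreal (4 * (1/4) ^ n))"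
    proof (intro Liminf_mono eventually_sequentiallyI)
      show "(\<integral>\<^sup>+x. ennreal ((norm (s m x - u n x))\<^sup>2) \<partial>M) \<le> ennreal (4 * (1/4) ^ n)" if "n \<le> m" for m
        using su[OF that] by (subst nn_integral_norm_sq[OF diff[OF s(2) u]]) (rule ennreal_leI)
    qed
    also have "\<dots> = ennreal (4 * (1/4) ^ n)" by (simp add: Liminf_const)
    finally show ?thesis .
  qed
  have svu: "strongly_measurable M (\<lambda>x. v x - u n x)" for n
    using strongly_measurable_add[OF sv, of "\<lambda>x. - u n x"] L2_function_scaleR[OF u, of "-1" n]
    by (simp add: L2_function_def)
  have vu: "L2_function M (\<lambda>x. v x - u n x)" for n
    unfolding L2_function_def
  proof
    show "integrable M (\<lambda>x. (norm (v x - u n x))\<^sup>2)"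
    proof (rule integrableI_bounded)
      show "(\<lambda>x. (norm (v x - u n x))\<^sup>2) \<in> borel_measurable M"
        using strongly_measurable_imp_borel[OF cm svu[of n]] by measurable
      show "(\<integral>\<^sup>+x. ennreal (norm ((norm (v x - u n x))\<^sup>2)) \<partial>M) < \<infinity>"
        using order_le_less_trans[OF nn[of n] ennreal_less_top] by simp
    qed
  qed (rule svu)
  have v: "L2_function M v"
    using L2_function_add[OF cm vu u, of 0 0] by simp
  have bound: "(LINT x|M. (norm (v x - u n x))\<^sup>2) \<le> 4 * (1/4) ^ n" for n
    using nn[of n] by (subst (asm) nn_integral_norm_sq[OF vu]) (simp add: ennreal_le_iff)
  have "(\<lambda>n. LINT x|M. (norm (v x - u n x))\<^sup>2) \<longlonglongrightarrow> 0"
  proof (rule tendsto_sandwich)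
    show "\<forall>\<^sub>F n in sequentially. 0 \<le> (LINT x|M. (norm (v x - u n x))\<^sup>2)"
      by simp
    show "\<forall>\<^sub>F n in sequentially. (LINT x|M. (norm (v x - u n x))\<^sup>2) \<le> 4 * (1/4) ^ n"
      using bound by simp
    have "(\<lambda>n. (1/4::real) ^ n) \<longlonglongrightarrow> 0"
      by (rule LIMSEQ_power_zero) simp
    then show "(\<lambda>n. 4 * (1/4::real) ^ n) \<longlonglongrightarrow> 0"
      by (rule tendsto_mult_right_zero)
  qed simp
  with v show thesis
    by (rule that)
qed

lemma complex_hilbert_parallelogram:
  fixes x y :: "'a::complex_hilbert"
  shows "(norm (x + y))\<^sup>2 + (norm (x - y))\<^sup>2 = 2 * (norm x)\<^sup>2 + 2 * (norm y)\<^sup>2"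
proof -
  have re: "(norm z)\<^sup>2 = Re (cinner z z)" for z :: 'a
    by (simp add: cinner_norm)
  have add_right: "cinner z (x + y) = cinner z x + cinner z y" for x y z :: 'a
    by (metis cinner_add_left cinner_commute complex_cnj_add)
  have neg: "(- 1) *\<^sub>C y = - y"
    using scaleC_of_real[of "-1" y] by simp
  have neg_left: "cinner (- y) z = - cinner y z" for z
    using cinner_scaleC_left[of "-1" y z] by (simp add: neg)
  have neg_right: "cinner z (- y) = - cinner z y" for z
    by (metis neg_left cinner_commute complex_cnj_minus)
  have "(norm (x + - y))\<^sup>2 = Re (cinner x x - cinner x y - cinner y x + cinner y y)"
    unfolding re by (simp add: cinner_add_left add_right neg_left neg_right del: add_uminus_conv_diff)
  moreover have "(norm (x + y))\<^sup>2 = Re (cinner x x + cinner x y + cinner y x + cinner y y)"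
    unfolding re by (simp add: cinner_add_left add_right)
  ultimately show ?thesis
    unfolding re[of x] re[of y] by simp
qed

lemma L2_parallelogram:
  fixes u v :: "'a \<Rightarrow> 'u::complex_hilbert"
  assumes cm: "complete_measure M" and u: "L2_function M u" and v: "L2_function M v"
  shows "(LINT x|M. (norm (u x + v x))\<^sup>2) + (LINT x|M. (norm (u x - v x))\<^sup>2)
    = 2 * (LINT x|M. (norm (u x))\<^sup>2) + 2 * (LINT x|M. (norm (v x))\<^sup>2)"
proof -
  have "(LINT x|M. (norm (u x + v x))\<^sup>2) + (LINT x|M. (norm (u x - v x))\<^sup>2)
      = (LINT x|M. (norm (u x + v x))\<^sup>2 + (norm (u x - v x))\<^sup>2)"
    using L2_function_add[OF cm u v] L2_function_diff[OF cm u v] by (simp add: L2_function_def)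
  also have "\<dots> = (LINT x|M. 2 * (norm (u x))\<^sup>2 + 2 * (norm (v x))\<^sup>2)"
    by (simp only: complex_hilbert_parallelogram)
  also have "\<dots> = 2 * (LINT x|M. (norm (u x))\<^sup>2) + 2 * (LINT x|M. (norm (v x))\<^sup>2)"
    using u v by (simp add: L2_function_def)
  finally show ?thesis .
qed

locale L2_quadratic =
  fixes M :: "'a measure" and L :: "('a \<Rightarrow> 'u::complex_hilbert) \<Rightarrow> 'w::real_normed_vector"
    and C \<kappa> :: real and a :: 'w
  assumes complete: "complete_measure M"
    and L_add: "\<And>u v. L2_function M u \<Longrightarrow> L2_function M v \<Longrightarrow> L (\<lambda>x. u x + v x) = L u + L v"
    and L_scale: "\<And>c u. L2_function M u \<Longrightarrow> L (\<lambda>x. c *\<^sub>R u x) = c *\<^sub>R L u"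
    and L_bound: "\<And>u. L2_function M u \<Longrightarrow> (norm (L u))\<^sup>2 \<le> C * (LINT x|M. (norm (u x))\<^sup>2)"
    and \<kappa>_pos: "\<kappa> > 0"
begin

definition J :: "('a \<Rightarrow> 'u) \<Rightarrow> real" where
  "J u = (norm (a + L u))\<^sup>2 + \<kappa> * (LINT x|M. (norm (u x))\<^sup>2)"

lemma J_nonneg: "J u \<ge> 0"
  using \<kappa>_pos by (simp add: J_def)

lemma J_midpoint:
  assumes u: "L2_function M u" and v: "L2_function M v"
  shows "L2_function M (\<lambda>x. (1/2) *\<^sub>R (u x + v x))"
    and "J (\<lambda>x. (1/2) *\<^sub>R (u x + v x)) + \<kappa> / 4 * (LINT x|M. (norm (u x - v x))\<^sup>2) \<le> (J u + J v) / 2"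
proof -
  note uv = L2_function_add[OF complete u v]
  show "L2_function M (\<lambda>x. (1/2) *\<^sub>R (u x + v x))"
    using uv by (rule L2_function_scaleR)
  have mid: "a + L (\<lambda>x. (1/2) *\<^sub>R (u x + v x)) = (1/2) *\<^sub>R ((a + L u) + (a + L v))"
  proof -
    have "(a + L u) + (a + L v) = (a + a) + (L u + L v)" by simp
    then show ?thesis
      by (simp only: L_scale[OF uv] L_add[OF u v] scaleR_right_distrib[of _ "a + a"] scaleR_half_double)
  qed
  have "(norm (a + L (\<lambda>x. (1/2) *\<^sub>R (u x + v x))))\<^sup>2 = 1/4 * (norm ((a + L u) + (a + L v)))\<^sup>2"
    unfolding mid by (simp add: power_divide)
  also have "\<dots> \<le> 1/4 * (2 * (norm (a + L u))\<^sup>2 + 2 * (norm (a + L v))\<^sup>2)"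
    by (intro mult_left_mono norm_add_sq_le_2) simp
  finally have 1: "(norm (a + L (\<lambda>x. (1/2) *\<^sub>R (u x + v x))))\<^sup>2
      \<le> ((norm (a + L u))\<^sup>2 + (norm (a + L v))\<^sup>2) / 2"
    by simp
  have "\<kappa> * (LINT x|M. (norm ((1/2) *\<^sub>R (u x + v x)))\<^sup>2) = \<kappa> / 4 * (LINT x|M. (norm (u x + v x))\<^sup>2)"
    by (simp add: power_divide)
  also have "(LINT x|M. (norm (u x + v x))\<^sup>2) = 2 * (LINT x|M. (norm (u x))\<^sup>2)
      + 2 * (LINT x|M. (norm (v x))\<^sup>2) - (LINT x|M. (norm (u x - v x))\<^sup>2)"
    using L2_parallelogram[OF complete u v] by simp
  finally show "J (\<lambda>x. (1/2) *\<^sub>R (u x + v x)) + \<kappa> / 4 * (LINT x|M. (norm (u x - v x))\<^sup>2) \<le> (J u + J v) / 2"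
    using 1 unfolding J_def by (simp add: algebra_simps)
qed

lemma J_diff_le:
  assumes lower: "\<And>w. L2_function M w \<Longrightarrow> m \<le> J w"
    and u: "L2_function M u" "J u \<le> m + \<delta>" and v: "L2_function M v" "J v \<le> m + \<delta>"
  shows "(LINT x|M. (norm (u x - v x))\<^sup>2) \<le> 4 * \<delta> / \<kappa>"
  using J_midpoint(2)[OF u(1) v(1)] lower[OF J_midpoint(1)[OF u(1) v(1)]] u(2) v(2) \<kappa>_pos
  by (simp add: field_simps)

lemma J_perturb:
  assumes u: "L2_function M u" and v: "L2_function M v" and "\<epsilon> > 0"
  shows "J v \<le> (1 + \<epsilon>) * J u + (1 + 1 / \<epsilon>) * ((C + \<kappa>) * (LINT x|M. (norm (v x - u x))\<^sup>2))"
proof -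
  define D where "D = (LINT x|M. (norm (v x - u x))\<^sup>2)"
  note vu = L2_function_diff[OF complete v u]
  have "L v = L u + L (\<lambda>x. v x - u x)"
    using L_add[OF u vu] by simp
  then have "(norm (a + L v))\<^sup>2 \<le> (1 + \<epsilon>) * (norm (a + L u))\<^sup>2 + (1 + 1 / \<epsilon>) * (norm (L (\<lambda>x. v x - u x)))\<^sup>2"
    using norm_add_sq_le[OF \<open>\<epsilon> > 0\<close>, of "a + L u" "L (\<lambda>x. v x - u x)"] by (simp add: add.assoc)
  also have "\<dots> \<le> (1 + \<epsilon>) * (norm (a + L u))\<^sup>2 + (1 + 1 / \<epsilon>) * (C * D)"
    unfolding D_def using L_bound[OF vu] \<open>\<epsilon> > 0\<close> by (intro add_left_mono mult_left_mono) auto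
  finally have 1: "(norm (a + L v))\<^sup>2 \<le> (1 + \<epsilon>) * (norm (a + L u))\<^sup>2 + (1 + 1 / \<epsilon>) * (C * D)" .
  have "(LINT x|M. (norm (v x))\<^sup>2)
      \<le> (LINT x|M. (1 + \<epsilon>) * (norm (u x))\<^sup>2 + (1 + 1 / \<epsilon>) * (norm (v x - u x))\<^sup>2)"
  proof (rule integral_mono)
    show "(norm (v x))\<^sup>2 \<le> (1 + \<epsilon>) * (norm (u x))\<^sup>2 + (1 + 1 / \<epsilon>) * (norm (v x - u x))\<^sup>2" for x
      using norm_add_sq_le[OF \<open>\<epsilon> > 0\<close>, of "u x" "v x - u x"] by simp
  qed (use u v vu in \<open>auto simp: L2_function_def\<close>)
  also have "\<dots> = (1 + \<epsilon>) * (LINT x|M. (norm (u x))\<^sup>2) + (1 + 1 / \<epsilon>) * D"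
    using u vu by (simp add: L2_function_def D_def)
  finally have 2: "\<kappa> * (LINT x|M. (norm (v x))\<^sup>2)
      \<le> \<kappa> * ((1 + \<epsilon>) * (LINT x|M. (norm (u x))\<^sup>2) + (1 + 1 / \<epsilon>) * D)"
    using \<kappa>_pos by (intro mult_left_mono) auto
  show ?thesis
    using 1 2 unfolding J_def D_def[symmetric] by (simp add: algebra_simps)
qed

lemma J_minimizer_exists:
  obtains u where "L2_function M u" "\<And>v. L2_function M v \<Longrightarrow> J u \<le> J v"
proof -
  define m where "m = (INF u\<in>{u. L2_function M u}. J u)"
  have bdd: "bdd_below (J ` {u. L2_function M u})"
    using J_nonneg by (intro bdd_belowI2[of _ 0]) auto
  have lower: "m \<le> J w" if "L2_function M w" for w
    unfolding m_def using bdd that by (intro cINF_lower) auto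
  have "L2_function M (\<lambda>_. 0 :: 'u)"
    unfolding L2_function_def strongly_measurable_def
    by (auto intro!: exI[of _ "\<lambda>_ _. 0"])
  then have ne: "{u. L2_function M u} \<noteq> ({} :: ('a \<Rightarrow> 'u) set)" by auto
  define \<delta> where "\<delta> n = \<kappa> / 4 * (1/4) ^ n" for n :: nat
  have "\<exists>u. L2_function M u \<and> J u < m + \<delta> n" for n
    using cINF_less_iff[OF ne bdd, of "m + \<delta> n"] \<kappa>_pos by (auto simp: m_def[symmetric] \<delta>_def)
  then obtain u where u: "\<And>n. L2_function M (u n)" "\<And>n. J (u n) < m + \<delta> n"
    by metis
  have "(LINT x|M. (norm (u k x - u n x))\<^sup>2) \<le> (1/4) ^ n" if "n \<le> k" for n k
  proof -
    have "\<delta> k \<le> \<delta> n"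
      unfolding \<delta>_def using that \<kappa>_pos by (intro mult_left_mono power_decreasing) auto
    then have "(LINT x|M. (norm (u k x - u n x))\<^sup>2) \<le> 4 * \<delta> n / \<kappa>"
      using u(2)[of k] u(2)[of n] by (intro J_diff_le[OF lower] u) auto
    then show ?thesis using \<kappa>_pos by (simp add: \<delta>_def)
  qed
  then obtain v where v: "L2_function M v" "(\<lambda>n. LINT x|M. (norm (v x - u n x))\<^sup>2) \<longlonglongrightarrow> 0"
    using L2_complete[where u=u, OF complete u(1)] by blast
  have le: "J v \<le> (1 + \<epsilon>) * m" if "\<epsilon> > 0" for \<epsilon>
  proof (rule tendsto_lowerbound)
    have "\<delta> \<longlonglongrightarrow> \<kappa> / 4 * 0"
      unfolding \<delta>_def by (intro tendsto_mult tendsto_const LIMSEQ_power_zero) simp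
    then have "(\<lambda>n. (1 + \<epsilon>) * (m + \<delta> n) + (1 + 1 / \<epsilon>) * ((C + \<kappa>) * (LINT x|M. (norm (v x - u n x))\<^sup>2)))
        \<longlonglongrightarrow> (1 + \<epsilon>) * (m + \<kappa> / 4 * 0) + (1 + 1 / \<epsilon>) * ((C + \<kappa>) * 0)"
      using v(2) by (intro tendsto_intros)
    then show "(\<lambda>n. (1 + \<epsilon>) * (m + \<delta> n) + (1 + 1 / \<epsilon>) * ((C + \<kappa>) * (LINT x|M. (norm (v x - u n x))\<^sup>2)))
        \<longlonglongrightarrow> (1 + \<epsilon>) * m"
      by simp
    have "(1 + \<epsilon>) * J (u n) \<le> (1 + \<epsilon>) * (m + \<delta> n)" for n
      using u(2)[of n] that by (intro mult_left_mono) auto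
    then show "\<forall>\<^sub>F n in sequentially. J v \<le> (1 + \<epsilon>) * (m + \<delta> n)
        + (1 + 1 / \<epsilon>) * ((C + \<kappa>) * (LINT x|M. (norm (v x - u n x))\<^sup>2))"
      using J_perturb[OF u(1) v(1) that] by (intro always_eventually allI) (smt (verit))
  qed simp
  have "J v \<le> m"
  proof (rule tendsto_lowerbound)
    show "((\<lambda>\<epsilon>. (1 + \<epsilon>) * m) \<longlongrightarrow> m) (at_right 0)"
      by (auto intro!: tendsto_eq_intros)
    show "\<forall>\<^sub>F \<epsilon> in at_right 0. J v \<le> (1 + \<epsilon>) * m"
      using eventually_at_right_less[of 0] by eventually_elim (rule le)
  qed simp
  with v(1) lower that show thesis by (meson order_trans)
qed

lemma J_minimizer_unique:
  assumes u: "L2_function M u" "\<And>w. L2_function M w \<Longrightarrow> J u \<le> J w"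
    and v: "L2_function M v" "\<And>w. L2_function M w \<Longrightarrow> J v \<le> J w"
  shows "AE x in M. u x = v x"
proof -
  have "(LINT x|M. (norm (u x - v x))\<^sup>2) \<le> 4 * 0 / \<kappa>"
    using u v by (intro J_diff_le[where m="J u"]) auto
  then have "(LINT x|M. (norm (u x - v x))\<^sup>2) = 0"
    by (intro antisym) auto
  then have "AE x in M. (norm (u x - v x))\<^sup>2 = 0"
    using L2_function_diff[OF complete u(1) v(1)]
    by (subst (asm) integral_nonneg_eq_0_iff_AE) (auto simp: L2_function_def)
  then show ?thesis by eventually_elim simp
qed

end

lemma complete_measure_lebesgue_on:
  assumes "S \<in> sets lebesgue"
  shows "complete_measure (lebesgue_on S)"
proof
  fix A B :: "'a set" assume "B \<subseteq> A" "A \<in> null_sets (lebesgue_on S)"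
  then have "A \<subseteq> S" "A \<in> null_sets lebesgue"
    using assms by (auto simp: null_sets_restrict_space)
  then have "B \<in> null_sets lebesgue" "B \<subseteq> S"
    using \<open>B \<subseteq> A\<close> completion.complete2 by auto
  then show "B \<in> sets (lebesgue_on S)"
    using assms by (auto simp: sets_restrict_space_iff)
qed

lemma AE_lebesgue_on_subset:
  assumes "A \<subseteq> S" "A \<in> sets lebesgue" "S \<in> sets lebesgue" "AE x in lebesgue_on S. P x"
  shows "AE x in lebesgue_on A. P x"
proof -
  have "AE x in lebesgue. x \<in> S \<longrightarrow> P x"
    using assms(3,4) by (simp add: AE_restrict_space_iff)
  then have "AE x in lebesgue. x \<in> A \<longrightarrow> P x"
    by eventually_elim (use assms(1) in auto)
  then show ?thesis
    using assms(2) by (simp add: AE_restrict_space_iff)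
qed

lemma strongly_measurable_lebesgue_on_subset:
  assumes "A \<subseteq> S" "A \<in> sets lebesgue" "S \<in> sets lebesgue" "strongly_measurable (lebesgue_on S) u"
  shows "strongly_measurable (lebesgue_on A) u"
proof -
  obtain s where s: "\<And>i::nat. simple_function (lebesgue_on S) (s i)"
    "AE x in lebesgue_on S. (\<lambda>i. s i x) \<longlonglongrightarrow> u x"
    using assms(4) unfolding strongly_measurable_def by metis
  have "simple_function (lebesgue_on A) (s i)" for i
    using s(1)[of i] assms(1) unfolding simple_function_eq_measurable
    by (auto intro: measurable_restrict_mono finite_subset[OF image_mono])
  moreover have "AE x in lebesgue_on A. (\<lambda>i. s i x) \<longlonglongrightarrow> u x"
    by (rule AE_lebesgue_on_subset[OF assms(1-3) s(2)])
  ultimately show ?thesis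
    unfolding strongly_measurable_def by blast
qed

lemma integral_lebesgue_on_subset:
  fixes f :: "'a::euclidean_space \<Rightarrow> 'b::{banach, second_countable_topology}"
  assumes "A \<subseteq> S" "A \<in> sets lebesgue" "S \<in> sets lebesgue"
  shows "(LINT x|lebesgue_on A. f x) = (LINT x|lebesgue_on S. indicator A x *\<^sub>R f x)"
    and "integrable (lebesgue_on A) f \<longleftrightarrow> integrable (lebesgue_on S) (\<lambda>x. indicator A x *\<^sub>R f x)"
proof -
  have *: "(\<lambda>x. indicator S x *\<^sub>R indicator A x *\<^sub>R f x) = (\<lambda>x. indicator A x *\<^sub>R f x)"
    using assms(1) by (intro ext) (auto split: split_indicator)
  have sets: "S \<inter> space lebesgue \<in> sets lebesgue" "A \<inter> space lebesgue \<in> sets lebesgue"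
    using assms(2,3) by auto
  show "(LINT x|lebesgue_on A. f x) = (LINT x|lebesgue_on S. indicator A x *\<^sub>R f x)"
    unfolding integral_restrict_space[OF sets(1)] integral_restrict_space[OF sets(2)] * ..
  show "integrable (lebesgue_on A) f \<longleftrightarrow> integrable (lebesgue_on S) (\<lambda>x. indicator A x *\<^sub>R f x)"
    unfolding integrable_restrict_space[OF sets(1)] integrable_restrict_space[OF sets(2)] * ..
qed

lemma L2_function_imp_integrable_norm:
  assumes "finite_measure M" "complete_measure M" and u: "L2_function M u"
  shows "integrable M (\<lambda>x. norm (u x))"
proof (rule Bochner_Integration.integrable_bound)
  interpret finite_measure M by fact
  show "integrable M (\<lambda>x. 1 + (norm (u x))\<^sup>2)"
    using u by (simp add: L2_function_def)
  have "u \<in> borel_measurable M"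
    using u assms(2) by (auto simp: L2_function_def intro: strongly_measurable_imp_borel)
  then show "(\<lambda>x. norm (u x)) \<in> borel_measurable M" by measurable
  have "norm y \<le> 1 + (norm y)\<^sup>2" for y :: 'b
  proof -
    have "0 \<le> (norm y - 1)\<^sup>2" by simp
    then have "2 * norm y \<le> 1 + (norm y)\<^sup>2" by (simp add: power2_diff)
    then show ?thesis using norm_ge_zero[of y] by linarith
  qed
  then show "AE x in M. norm (norm (u x)) \<le> norm (1 + (norm (u x))\<^sup>2)"
    by simp
qed

lemma square_integral_norm_le:
  assumes "finite_measure M" "complete_measure M" and u: "L2_function M u"
  shows "(LINT x|M. norm (u x))\<^sup>2 \<le> measure M (space M) * (LINT x|M. (norm (u x))\<^sup>2)"
proof -
  interpret finite_measure M by fact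
  define I where "I = (LINT x|M. norm (u x))"
  define \<mu> where "\<mu> = measure M (space M)"
  note int = L2_function_imp_integrable_norm[OF assms]
  have int2: "integrable M (\<lambda>x. (norm (u x))\<^sup>2)" using u by (simp add: L2_function_def)
  have "0 \<le> (LINT x|M. (\<mu> * norm (u x) - I)\<^sup>2)" by simp
  also have "\<dots> = (LINT x|M. \<mu>\<^sup>2 * (norm (u x))\<^sup>2 - 2 * \<mu> * I * norm (u x) + I\<^sup>2)"
    by (simp add: power2_eq_square algebra_simps)
  also have "\<dots> = \<mu>\<^sup>2 * (LINT x|M. (norm (u x))\<^sup>2) - 2 * \<mu> * I * I + \<mu> * I\<^sup>2"
    using int int2 by (simp add: I_def[symmetric] \<mu>_def)
  finally have "0 \<le> \<mu> * (\<mu> * (LINT x|M. (norm (u x))\<^sup>2) - I\<^sup>2)"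
    by (simp add: power2_eq_square algebra_simps)
  moreover have "I\<^sup>2 = 0" if "\<mu> = 0"
  proof -
    have "space M \<in> null_sets M"
      using that by (intro null_setsI) (auto simp: \<mu>_def emeasure_eq_measure)
    then have "AE x in M. norm (u x) = 0"
      by (rule AE_I') auto
    then have "I = 0" unfolding I_def by (rule integral_eq_zero_AE)
    then show ?thesis by simp
  qed
  moreover have "\<mu> \<ge> 0" by (simp add: \<mu>_def)
  ultimately show ?thesis
    unfolding I_def[symmetric] \<mu>_def[symmetric]
    by (cases "\<mu> = 0") (auto simp: zero_le_mult_iff)
qed

locale operator_convolution =
  fixes S :: "real \<Rightarrow> 'u::banach \<Rightarrow> 'w::{banach, second_countable_topology}" and T K :: real
  assumes T_pos: "T > 0"
    and S_linear: "\<And>t. t \<in> {0..T} \<Longrightarrow> bounded_linear (S t)"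
    and S_bound: "\<And>t x. t \<in> {0..T} \<Longrightarrow> norm (S t x) \<le> K * norm x"
    and S_cont: "\<And>x. continuous_on {0..T} (\<lambda>t. S t x)"
begin

abbreviation "\<M> \<equiv> lebesgue_on {0..T}"

lemma complete: "complete_measure \<M>"
  by (rule complete_measure_lebesgue_on) simp

lemma finite: "finite_measure \<M>"
  by (rule finite_measure_lebesgue_on) simp

lemma K_norm_nonneg: "0 \<le> K * norm (x :: 'u)"
  using order_trans[OF norm_ge_zero S_bound[of 0 x]] T_pos by simp

definition conv :: "(real \<Rightarrow> 'u) \<Rightarrow> real \<Rightarrow> 'w" where
  "conv u t = (LINT s|lebesgue_on {0..t}. S (t - s) (u s))"

lemma measurable_integrand:
  assumes u: "L2_function \<M> u" and t: "t \<in> {0..T}"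
  shows "(\<lambda>s. S (t - s) (u s)) \<in> borel_measurable (lebesgue_on {0..t})"
proof -
  have "strongly_measurable (lebesgue_on {0..t}) u"
    using u t by (intro strongly_measurable_lebesgue_on_subset[of "{0..t}" "{0..T}"])
      (auto simp: L2_function_def)
  then obtain s where s: "\<And>i::nat. simple_function (lebesgue_on {0..t}) (s i)"
    "AE x in lebesgue_on {0..t}. (\<lambda>i. s i x) \<longlonglongrightarrow> u x"
    unfolding strongly_measurable_def by metis
  show ?thesis
  proof (rule borel_measurable_AE_limit)
    show "complete_measure (lebesgue_on {0..t})"
      by (rule complete_measure_lebesgue_on) simp
    show "(\<lambda>x. S (t - x) (s i x)) \<in> borel_measurable (lebesgue_on {0..t})" for i
    proof (rule measurable_compose_countable'[where f="\<lambda>y x. S (t - x) y" and g="s i" and I="s i ` {0..t}"])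
      have "continuous_on {0..t} (\<lambda>x. S (t - x) y)" for y
        using t by (intro continuous_on_compose2[OF S_cont] continuous_intros) auto
      then show "(\<lambda>x. S (t - x) y) \<in> borel_measurable (lebesgue_on {0..t})" for y
        by (intro continuous_imp_measurable_on_sets_lebesgue) auto
      have fin: "finite (s i ` {0..t})"
        using simple_functionD(1)[OF s(1)[of i]] by simp
      then show "countable (s i ` {0..t})" by (rule countable_finite)
      show "s i \<in> lebesgue_on {0..t} \<rightarrow>\<^sub>M count_space (s i ` {0..t})"
        using s(1)[of i] fin by (auto simp: measurable_count_space_eq2 simple_function_def)
    qed
    show "AE x in lebesgue_on {0..t}. (\<lambda>i. S (t - x) (s i x)) \<longlonglongrightarrow> S (t - x) (u x)"
      using s(2)
    proof (rule lebesgue_on_mono)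
      fix x assume "(\<lambda>i. s i x) \<longlonglongrightarrow> u x" "x \<in> {0..t}"
      then show "(\<lambda>i. S (t - x) (s i x)) \<longlonglongrightarrow> S (t - x) (u x)"
        using t by (intro bounded_linear.tendsto[OF S_linear]) auto
    qed
  qed
qed

lemma norm_integrable: "L2_function \<M> u \<Longrightarrow> integrable \<M> (\<lambda>s. K * norm (u s))"
  by (intro integrable_mult_right L2_function_imp_integrable_norm[OF finite complete])

lemma integrable_integrand:
  assumes u: "L2_function \<M> u" and t: "t \<in> {0..T}"
  shows "integrable (lebesgue_on {0..t}) (\<lambda>s. S (t - s) (u s))"
proof (rule Bochner_Integration.integrable_bound)
  have sub: "{0..t} \<subseteq> {0..T}" using t by auto
  have "integrable \<M> (\<lambda>s. indicator {0..t} s *\<^sub>R (K * norm (u s)))"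
    using norm_integrable[OF u] sub
    by (intro integrable_mult_indicator) (auto simp: sets_restrict_space_iff)
  then show "integrable (lebesgue_on {0..t}) (\<lambda>s. K * norm (u s))"
    using sub by (subst integral_lebesgue_on_subset(2)[of _ "{0..T}"]) auto
  show "(\<lambda>s. S (t - s) (u s)) \<in> borel_measurable (lebesgue_on {0..t})"
    using u t by (rule measurable_integrand)
  have "norm (S (t - s) (u s)) \<le> norm (K * norm (u s))" if "s \<in> {0..t}" for s
    using S_bound[of "t - s" "u s"] t that K_norm_nonneg[of "u s"] by auto
  then show "AE s in lebesgue_on {0..t}. norm (S (t - s) (u s)) \<le> norm (K * norm (u s))"
    by (intro AE_I2) simp
qed

lemma conv_add:
  assumes "L2_function \<M> u" "L2_function \<M> v" "t \<in> {0..T}"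
  shows "conv (\<lambda>s. u s + v s) t = conv u t + conv v t"
proof -
  have "conv (\<lambda>s. u s + v s) t = (LINT s|lebesgue_on {0..t}. S (t - s) (u s) + S (t - s) (v s))"
    unfolding conv_def using assms(3)
    by (intro Bochner_Integration.integral_cong refl)
       (auto intro!: linear_add bounded_linear.linear[OF S_linear])
  also have "\<dots> = conv u t + conv v t"
    unfolding conv_def using assms by (intro Bochner_Integration.integral_add integrable_integrand)
  finally show ?thesis .
qed

lemma conv_scaleR:
  assumes "t \<in> {0..T}"
  shows "conv (\<lambda>s. c *\<^sub>R u s) t = c *\<^sub>R conv u t"
proof -
  have "conv (\<lambda>s. c *\<^sub>R u s) t = (LINT s|lebesgue_on {0..t}. c *\<^sub>R S (t - s) (u s))"
    unfolding conv_def using assms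
    by (intro Bochner_Integration.integral_cong refl)
       (auto intro!: linear_scale bounded_linear.linear[OF S_linear])
  then show ?thesis by (simp add: conv_def)
qed

lemma conv_bound:
  assumes u: "L2_function \<M> u"
  shows "(norm (conv u T))\<^sup>2 \<le> K\<^sup>2 * T * (LINT s|\<M>. (norm (u s))\<^sup>2)"
proof -
  have "norm (conv u T) \<le> (LINT s|\<M>. K * norm (u s))"
    unfolding conv_def
  proof (rule order_trans[OF integral_norm_bound integral_mono])
    have *: "integrable \<M> (\<lambda>s. S (T - s) (u s))"
      using u T_pos by (intro integrable_integrand) auto
    then show "integrable \<M> (\<lambda>s. norm (S (T - s) (u s)))"
      by (rule integrable_norm)
    show "norm (S (T - s) (u s)) \<le> K * norm (u s)" if "s \<in> space \<M>" for s
      using that by (intro S_bound) auto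
  qed (rule norm_integrable[OF u])
  then have "(norm (conv u T))\<^sup>2 \<le> (K * (LINT s|\<M>. norm (u s)))\<^sup>2"
    by (intro power_mono) auto
  also have "\<dots> \<le> K\<^sup>2 * (measure \<M> (space \<M>) * (LINT s|\<M>. (norm (u s))\<^sup>2))"
    unfolding power_mult_distrib
    by (intro mult_left_mono square_integral_norm_le[OF finite complete u]) simp
  also have "measure \<M> (space \<M>) = T"
    using T_pos by (simp add: measure_restrict_space)
  finally show ?thesis by (simp add: mult.assoc)
qed

lemma conv_cong_AE:
  assumes u: "L2_function \<M> u" and v: "L2_function \<M> v" and t: "t \<in> {0..T}"
    and eq: "AE s in \<M>. u s = v s"
  shows "conv u t = conv v t"
  unfolding conv_def
proof (rule integral_cong_AE)
  have "AE s in lebesgue_on {0..t}. u s = v s"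
    using t eq by (intro AE_lebesgue_on_subset[of "{0..t}" "{0..T}"]) auto
  then show "AE s in lebesgue_on {0..t}. S (t - s) (u s) = S (t - s) (v s)"
    by eventually_elim simp
qed (use u v t measurable_integrand in auto)

lemma continuous_on_conv:
  assumes u: "L2_function \<M> u"
  shows "continuous_on {0..T} (conv u)"
proof (rule continuous_on_sequentiallyI)
  fix r t assume r: "\<forall>n. r n \<in> {0..T}" and t: "t \<in> {0..T}" and lim: "r \<longlonglongrightarrow> t"
  define g where "g \<tau> s = indicator {0..\<tau>} s *\<^sub>R S (\<tau> - s) (u s)" for \<tau> s
  have conv: "conv u \<tau> = (LINT s|\<M>. g \<tau> s)" and int: "integrable \<M> (g \<tau>)" if "\<tau> \<in> {0..T}" for \<tau>
    using that integrable_integrand[OF u that]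
      integral_lebesgue_on_subset[of "{0..\<tau>}" "{0..T}" "\<lambda>s. S (\<tau> - s) (u s)"]
    unfolding conv_def g_def by auto
  have "(\<lambda>n. LINT s|\<M>. g (r n) s) \<longlonglongrightarrow> (LINT s|\<M>. g t s)"
  proof (rule integral_dominated_convergence[where w="\<lambda>s. K * norm (u s)"])
    show "integrable \<M> (\<lambda>s. K * norm (u s))" by (rule norm_integrable[OF u])
    show "AE s in \<M>. norm (g (r n) s) \<le> K * norm (u s)" for n
    proof (rule AE_I2)
      fix s assume "s \<in> space \<M>"
      show "norm (g (r n) s) \<le> K * norm (u s)"
      proof (cases "s \<in> {0..r n}")
        case True
        then show ?thesis
          using r S_bound[of "r n - s" "u s"] by (auto simp: g_def order_trans[of "r n - s" "r n" T])
      next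
        case False
        then show ?thesis
          using K_norm_nonneg[of "u s"] by (simp add: g_def)
      qed
    qed
    have "AE s in lebesgue. s \<noteq> t"
      using AE_lborel_singleton[of t] by (rule AE_completion)
    then have "AE s in \<M>. s \<noteq> t"
      by (simp add: AE_restrict_space_iff) (auto elim: eventually_mono)
    then show "AE s in \<M>. (\<lambda>n. g (r n) s) \<longlonglongrightarrow> g t s"
    proof (rule lebesgue_on_mono)
      fix s assume "s \<noteq> t" "s \<in> {0..T}"
      then consider "s < t" | "t < s" by linarith
      then show "(\<lambda>n. g (r n) s) \<longlonglongrightarrow> g t s"
      proof cases
        case 1
        have ev: "\<forall>\<^sub>F n in sequentially. s < r n"
          using lim 1 by (rule order_tendstoD)
        have "(\<lambda>n. S (r n - s) (u s)) \<longlonglongrightarrow> S (t - s) (u s)"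
        proof (rule continuous_on_tendsto_compose[OF S_cont])
          show "(\<lambda>n. r n - s) \<longlonglongrightarrow> t - s" using lim by (intro tendsto_intros)
          show "t - s \<in> {0..T}" using 1 t \<open>s \<in> {0..T}\<close> by auto
          show "\<forall>\<^sub>F n in sequentially. r n - s \<in> {0..T}"
            using ev
          proof eventually_elim
            case (elim n)
            then show ?case using r[rule_format, of n] \<open>s \<in> {0..T}\<close> by auto
          qed
        qed
        moreover have "\<forall>\<^sub>F n in sequentially. S (r n - s) (u s) = g (r n) s"
          using ev by eventually_elim (use \<open>s \<in> {0..T}\<close> in \<open>auto simp: g_def\<close>)
        moreover have "g t s = S (t - s) (u s)"
          using 1 \<open>s \<in> {0..T}\<close> by (simp add: g_def)
        ultimately show ?thesis
          using Lim_transform_eventually by fastforce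
      next
        case 2
        have "\<forall>\<^sub>F n in sequentially. r n < s"
          using lim 2 by (rule order_tendstoD)
        then have "\<forall>\<^sub>F n in sequentially. g (r n) s = g t s"
          by eventually_elim (use 2 in \<open>simp add: g_def\<close>)
        then show ?thesis by (rule tendsto_eventually)
      qed
    qed
  qed (use int r t in auto)
  then show "(\<lambda>n. conv u (r n)) \<longlonglongrightarrow> conv u t"
    using r t conv by simp
qed

end

theorem theorem3p1:
  fixes DA :: "'w::{complex_banach, second_countable_topology} set" and A :: "'w \<Rightarrow> 'w"
    and G :: "real \<Rightarrow> 'w \<Rightarrow> 'w" and Gh :: "complex \<Rightarrow> 'w \<Rightarrow> 'w"
    and DN :: "real \<Rightarrow> 'w set" and N :: "real \<Rightarrow> 'w \<Rightarrow> 'w" and Nh :: "complex \<Rightarrow> 'w \<Rightarrow> 'w"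
    and P :: "real \<Rightarrow> real" and Y :: "'w set"
    and R :: "real \<Rightarrow> 'w \<Rightarrow> 'w" and B :: "'u::complex_hilbert \<Rightarrow> 'w"
    and T \<nu> M0 \<alpha> N1 N2 M1 M2 \<kappa> :: real and \<zeta>1 :: 'w
  assumes "T > 0"
    and "reflexive_space TYPE('w)"
    and "uniformly_convex_dual TYPE('w)"
    and "closed_clinear_operator DA A"
    and "bounded_clinear B"
    and "Cd1 DA A \<nu> M0"
    and "Cd2 DA A \<nu> G Gh \<alpha> N1 N2"
    and "Cd3 DA A \<nu> DN N Nh P"
    and "Cd4 DA A \<nu> Gh \<alpha> Nh Y M1 M2"
    and "resolvent_operator DA A G N R"
    and "\<kappa> > 0"
  shows "\<forall>\<zeta>. \<exists>!p. is_arg_min (cost T \<kappa> \<zeta>1) (\<lambda>q. q \<in> admissible T R B \<zeta>) p"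
proof
  fix \<zeta> :: 'w
  have R_linear: "\<And>t. t \<ge> 0 \<Longrightarrow> bounded_linear (R t)"
    and R_cont: "\<And>z. continuous_on {0..} (\<lambda>t. R t z)"
    using \<open>resolvent_operator DA A G N R\<close> by (auto simp: resolvent_operator_def bounded_clinear_def)
  obtain m \<omega> where R_bound: "\<And>t. t \<ge> 0 \<Longrightarrow> onorm (R t) \<le> m * exp (\<omega> * t)"
    using \<open>resolvent_operator DA A G N R\<close> by (auto simp: resolvent_operator_def)
  have B_linear: "bounded_linear B"
    using \<open>bounded_clinear B\<close> by (simp add: bounded_clinear_def)
  obtain b where b: "\<And>x. norm (B x) \<le> b * norm x"
    using bounded_linear.bounded[OF B_linear] by (auto simp: mult.commute)
  define k where "k = \<bar>m\<bar> * exp (\<bar>\<omega>\<bar> * T)"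
  have Rk: "norm (R t x) \<le> k * norm x" if "t \<in> {0..T}" for t x
  proof -
    have "norm (R t x) \<le> onorm (R t) * norm x"
      using that R_linear by (intro onorm) auto
    also have "m * exp (\<omega> * t) \<le> \<bar>m\<bar> * exp (\<bar>\<omega>\<bar> * T)"
      using that by (intro mult_mono) (auto intro!: mult_mono)
    then have "onorm (R t) * norm x \<le> k * norm x"
      using that R_bound[of t] unfolding k_def by (intro mult_right_mono) auto
    finally show ?thesis .
  qed
  interpret operator_convolution "\<lambda>t x. R t (B x)" T "k * b"
  proof (rule operator_convolution.intro)
    show "bounded_linear (\<lambda>x. R t (B x))" if "t \<in> {0..T}" for t
      using that by (intro bounded_linear_compose[OF R_linear B_linear]) auto
    show "norm (R t (B x)) \<le> k * b * norm x" if "t \<in> {0..T}" for t x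
    proof -
      have "norm (R t (B x)) \<le> k * norm (B x)" by (rule Rk[OF that])
      also have "\<dots> \<le> k * (b * norm x)"
        by (intro mult_left_mono b) (simp add: k_def)
      finally show ?thesis by (simp add: mult.assoc)
    qed
    show "continuous_on {0..T} (\<lambda>t. R t (B x))" for x
      by (rule continuous_on_subset[OF R_cont]) auto
  qed fact
  interpret L2_quadratic \<M> "\<lambda>u. conv u T" "(k * b)\<^sup>2 * T" \<kappa> "R T \<zeta> - \<zeta>1"
    using complete conv_bound \<open>\<kappa> > 0\<close> T_pos by (intro L2_quadratic.intro) (auto intro: conv_add conv_scaleR)
  have sq: "square_integrable T u \<longleftrightarrow> L2_function \<M> u" for u :: "real \<Rightarrow> 'u"
    by (simp add: square_integrable_def L2_function_def)
  have equiv: "equiv (Collect (L2_function \<M>)) (ae_equal T :: ((real \<Rightarrow> 'u) \<times> (real \<Rightarrow> 'u)) set)"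
  proof (rule equivI)
    show "trans (ae_equal T :: ((real \<Rightarrow> 'u) \<times> (real \<Rightarrow> 'u)) set)"
      by (rule transI) (auto simp: ae_equal_def elim: eventually_elim2)
  qed (auto simp: ae_equal_def sq refl_on_def sym_def elim: eventually_mono)
  define pair where "pair u = (restrict (\<lambda>t. R t \<zeta> + conv u t) {0..T}, ae_equal T `` {u})"
    for u :: "real \<Rightarrow> 'u"
  have pair_eq: "pair u = pair v" if "(u, v) \<in> ae_equal T" for u v
  proof -
    have "conv u t = conv v t" if "t \<in> {0..T}" for t
      using \<open>(u, v) \<in> ae_equal T\<close> that by (intro conv_cong_AE) (auto simp: ae_equal_def sq)
    moreover have "ae_equal T `` {u} = ae_equal T `` {v}"
      using that by (rule equiv_class_eq[OF equiv])
    ultimately show ?thesis by (simp add: pair_def cong: restrict_cong)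
  qed
  have self: "u \<in> ae_equal T `` {u}" if "L2_function \<M> u" for u :: "real \<Rightarrow> 'u"
    using that by (auto simp: ae_equal_def sq)
  have adm: "admissible T R B \<zeta> = pair ` Collect (L2_function \<M>)"
  proof (intro equalityI subsetI)
    fix p assume p: "p \<in> admissible T R B \<zeta>"
    obtain w U where "p = (w, U)" by (cases p)
    with p have U: "U \<in> L2_space T" and w: "w \<in> extensional {0..T}"
      and mild: "\<And>u. u \<in> U \<Longrightarrow> mild_solution T R B \<zeta> u w"
      by (auto simp: admissible_def)
    then obtain u where u: "L2_function \<M> u" "U = ae_equal T `` {u}"
      by (auto simp: L2_space_def quotient_def sq)
    have "w = restrict (\<lambda>t. R t \<zeta> + conv u t) {0..T}"
      using mild[of u] self[OF u(1)] w u(2)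
      by (intro extensionalityI[OF w]) (auto simp: mild_solution_def conv_def)
    then show "p \<in> pair ` Collect (L2_function \<M>)"
      using u \<open>p = (w, U)\<close> by (auto simp: pair_def)
  next
    fix p assume "p \<in> pair ` Collect (L2_function \<M>)"
    then obtain u where u: "L2_function \<M> u" "p = pair u" by auto
    have "ae_equal T `` {u} \<in> L2_space T"
      using u(1) by (auto simp: L2_space_def sq intro: quotientI)
    moreover have "continuous_on {0..T} (\<lambda>t. R t \<zeta> + conv u t)"
      by (intro continuous_on_add continuous_on_conv u(1) continuous_on_subset[OF R_cont]) auto
    then have "continuous_on {0..T} (restrict (\<lambda>t. R t \<zeta> + conv u t) {0..T})"
      by (rule continuous_on_eq) simp
    moreover have "mild_solution T R B \<zeta> v (restrict (\<lambda>t. R t \<zeta> + conv u t) {0..T})"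
      if "(u, v) \<in> ae_equal T" for v
      using pair_eq[OF that] unfolding mild_solution_def pair_def prod.inject
      by (auto simp: conv_def)
    ultimately show "p \<in> admissible T R B \<zeta>"
      unfolding u(2) admissible_def pair_def by auto
  qed
  have cost: "cost T \<kappa> \<zeta>1 (pair u) = J u" if "L2_function \<M> u" for u
  proof -
    have "L2_norm_sq T (ae_equal T `` {u}) = (LINT t|\<M>. (norm (u t))\<^sup>2)"
      using that self[OF that] by (intro L2_norm_sq_eq) (auto simp: L2_space_def sq intro: quotientI)
    then show ?thesis
      using T_pos by (simp add: cost_def pair_def J_def algebra_simps)
  qed
  have min_iff: "is_arg_min (cost T \<kappa> \<zeta>1) (\<lambda>q. q \<in> admissible T R B \<zeta>) (pair u)
      \<longleftrightarrow> (\<forall>v. L2_function \<M> v \<longrightarrow> J u \<le> J v)" if "L2_function \<M> u" for u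
    using that by (auto simp: is_arg_min_linorder adm cost simp del: split_paired_All)
  obtain u where u: "L2_function \<M> u" "\<And>v. L2_function \<M> v \<Longrightarrow> J u \<le> J v"
    using J_minimizer_exists by blast
  show "\<exists>!p. is_arg_min (cost T \<kappa> \<zeta>1) (\<lambda>q. q \<in> admissible T R B \<zeta>) p"
  proof (rule ex1I)
    show "is_arg_min (cost T \<kappa> \<zeta>1) (\<lambda>q. q \<in> admissible T R B \<zeta>) (pair u)"
      using u min_iff by auto
    fix p assume p: "is_arg_min (cost T \<kappa> \<zeta>1) (\<lambda>q. q \<in> admissible T R B \<zeta>) p"
    then obtain v where v: "L2_function \<M> v" "p = pair v"
      by (auto simp: is_arg_min_def adm)
    then have "AE t in \<M>. v t = u t"
      using p u min_iff[OF v(1)] by (intro J_minimizer_unique) auto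
    then show "p = pair u"
      unfolding v(2) using u(1) v(1) by (intro pair_eq) (auto simp: ae_equal_def sq)
  qed
qed

end
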